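(* Let $(X,r)$ be a finite non-degenerate solution of the Yang--Baxter equation. Then the group $G(X,r)$ is torsion-free if and only if the injectivization of $(X,r)$ is an involutive solution.
   Context: A solution of the Yang--Baxter equation is a pair $(X,r)$ with $X$ a non-empty set and $r\colon X\times X\to X\times X$ a bijective map with $r_1r_2r_1=r_2r_1r_2$ on $X^3$, where $r_1=r\times\mathrm{id}$, $r_2=\mathrm{id}\times r$. Write $r(x,y)=(\sigma_x(y),\tau_y(x))$. It is non-degenerate if all $\sigma_x$ and $\tau_x$ are bijective, involutive if $r^2=\mathrm{id}_{X\times X}$, and finite if $X$ is finite. The structure group is $G(X,r)=\langle X\mid xy=\sigma_x(y)\tau_y(x)\text{ for }x,y\in X\rangle$. A skew left brace is a triple $(A,+,\circ)$ with $(A,+)$, $(A,\circ)$ groups such that $a\circ(b+c)=a\circ b-a+a\circ c$; put $\lambda_a(b)=-a+a\circ b$. Each skew left brace $A$ gives a solution $r_A(a,b)=(\lambda_a(b),\lambda_a(b)'\circ a\circ b)$, where $c'$ is the inverse of $c$ in $(A,\circ)$. It is known that for a non-degenerate solution $(X,r)$ there is a unique skew left brace structure on $G(X,r)$, whose multiplicative group is the structure group, such that $r_{G(X,r)}(\iota\times\iota)=(\iota\times\iota)r$, where $\iota\colon X\to G(X,r)$ is the canonical map; its additive group is isomorphic to $A(X,r)=\langle X\mid x+\sigma_x(y)=\sigma_x(y)+\sigma_{\sigma_x(y)}(\tau_y(x))\text{ for }x,y\in X\rangle$ (with generators corresponding to $\iota(x)$). The injectivization of $(X,r)$ is the solution $(\tilde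 X,\tilde r)$ where $\tilde X=\iota(X)$ and $\tilde r\colon\tilde X\times\tilde X\to\tilde X\times\tilde X$ is the restriction of $r_{G(X,r)}$; one has $G(\tilde X,\tilde r)\cong G(X,r)$. *)

theory Defs
  imports "HOL-Algebra.Group"
begin

section \<open>Groups given by generators and relations\<close>

text \<open>A group word is a list of signed letters: \<open>(x, True)\<close> stands for \<open>x\<close> and
  \<open>(x, False)\<close> for its inverse. A relation \<open>s = t\<close> is a pair \<open>(s, t)\<close> of words.\<close>

type_synonym 'a gword = "('a \<times> bool) list"

definition gwords :: "'a set \<Rightarrow> 'a gword set" where
  "gwords X = lists (X \<times> UNIV)"

inductive_set pres_rel :: "'a set \<Rightarrow> ('a gword \<times> 'a gword) set \<Rightarrow> ('a gword \<times> 'a gword) set"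
  for X :: "'a set" and R :: "('a gword \<times> 'a gword) set"
where
  refl: "w \<in> gwords X \<Longrightarrow> (w, w) \<in> pres_rel X R"
| sym: "(v, w) \<in> pres_rel X R \<Longrightarrow> (w, v) \<in> pres_rel X R"
| trans: "(u, v) \<in> pres_rel X R \<Longrightarrow> (v, w) \<in> pres_rel X R \<Longrightarrow> (u, w) \<in> pres_rel X R"
| cancel: "x \<in> X \<Longrightarrow> u \<in> gwords X \<Longrightarrow> v \<in> gwords X
    \<Longrightarrow> (u @ [(x, b), (x, \<not> b)] @ v, u @ v) \<in> pres_rel X R"
| relation: "(s, t) \<in> R \<Longrightarrow> s \<in> gwords X \<Longrightarrow> t \<in> gwords X \<Longrightarrow> u \<in> gwords X \<Longrightarrow> v \<in> gwords X
    \<Longrightarrow> (u @ s @ v, u @ t @ v) \<in> pres_rel X R"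

definition presented_group ::
    "'a set \<Rightarrow> ('a gword \<times> 'a gword) set \<Rightarrow> 'a gword set monoid" where
  "presented_group X R =
    \<lparr> carrier = gwords X // pres_rel X R,
      mult = (\<lambda>A B. pres_rel X R `` {u @ v | u v. u \<in> A \<and> v \<in> B}),
      one = pres_rel X R `` {[]} \<rparr>"

definition torsion_free :: "('g, 'm) monoid_scheme \<Rightarrow> bool" where
  "torsion_free G \<longleftrightarrow>
    (\<forall>g\<in>carrier G. \<forall>n::nat. n > 0 \<longrightarrow> g [^]\<^bsub>G\<^esub> n = \<one>\<^bsub>G\<^esub> \<longrightarrow> g = \<one>\<^bsub>G\<^esub>)"


section \<open>Set-theoretic solutions of the Yang--Baxter equation\<close>

definition ybe_sigma :: "('a \<times> 'a \<Rightarrow> 'a \<times> 'a) \<Rightarrow> 'a \<Rightarrow> 'a \<Rightarrow> 'a" where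
  "ybe_sigma r x y = fst (r (x, y))"

text \<open>The subscript comes first: \<open>ybe_tau r y x\<close> is the second component of \<open>r (x, y)\<close>.\<close>

definition ybe_tau :: "('a \<times> 'a \<Rightarrow> 'a \<times> 'a) \<Rightarrow> 'a \<Rightarrow> 'a \<Rightarrow> 'a" where
  "ybe_tau r y x = snd (r (x, y))"

definition ybe_r1 :: "('a \<times> 'a \<Rightarrow> 'a \<times> 'a) \<Rightarrow> 'a \<times> 'a \<times> 'a \<Rightarrow> 'a \<times> 'a \<times> 'a" where
  "ybe_r1 r = (\<lambda>(x, y, z). case r (x, y) of (x', y') \<Rightarrow> (x', y', z))"

definition ybe_r2 :: "('a \<times> 'a \<Rightarrow> 'a \<times> 'a) \<Rightarrow> 'a \<times> 'a \<times> 'a \<Rightarrow> 'a \<times> 'a \<times> 'a" where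
  "ybe_r2 r = (\<lambda>(x, y, z). (x, r (y, z)))"

locale ybe_solution =
  fixes X :: "'a set" and r :: "'a \<times> 'a \<Rightarrow> 'a \<times> 'a"
  assumes nonempty: "X \<noteq> {}"
    and bijective: "bij_betw r (X \<times> X) (X \<times> X)"
    and braid: "p \<in> X \<times> X \<times> X \<Longrightarrow>
      ybe_r1 r (ybe_r2 r (ybe_r1 r p)) = ybe_r2 r (ybe_r1 r (ybe_r2 r p))"

locale nondegenerate_solution = ybe_solution +
  assumes sigma_bij: "x \<in> X \<Longrightarrow> bij_betw (ybe_sigma r x) X X"
    and tau_bij: "x \<in> X \<Longrightarrow> bij_betw (ybe_tau r x) X X"

locale involutive_solution = ybe_solution +
  assumes involutive: "p \<in> X \<times> X \<Longrightarrow> r (r p) = p"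


section \<open>The structure group\<close>

definition structure_relations ::
    "'a set \<Rightarrow> ('a \<times> 'a \<Rightarrow> 'a \<times> 'a) \<Rightarrow> ('a gword \<times> 'a gword) set" where
  "structure_relations X r =
    {([(x, True), (y, True)], [(ybe_sigma r x y, True), (ybe_tau r y x, True)])
      | x y. x \<in> X \<and> y \<in> X}"

definition structure_group ::
    "'a set \<Rightarrow> ('a \<times> 'a \<Rightarrow> 'a \<times> 'a) \<Rightarrow> 'a gword set monoid" where
  "structure_group X r = presented_group X (structure_relations X r)"

definition structure_iota ::
    "'a set \<Rightarrow> ('a \<times> 'a \<Rightarrow> 'a \<times> 'a) \<Rightarrow> 'a \<Rightarrow> 'a gword set" where
  "structure_iota X r x = pres_rel X (structure_relations X r) `` {[(x, True)]}"


section \<open>Skew left braces and the injectivization\<close>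

text \<open>A skew left brace is a pair of groups on the same carrier; \<open>A\<close> is the additive group
  (not assumed abelian, and written multiplicatively below) and \<open>M\<close> the multiplicative group.\<close>

locale skew_left_brace = add: group A + mult: group M
  for A :: "'g monoid" and M :: "'g monoid" +
  assumes same_carrier: "carrier A = carrier M"
    and brace: "\<lbrakk>a \<in> carrier M; b \<in> carrier M; c \<in> carrier M\<rbrakk> \<Longrightarrow>
      a \<otimes>\<^bsub>M\<^esub> (b \<otimes>\<^bsub>A\<^esub> c) = (a \<otimes>\<^bsub>M\<^esub> b) \<otimes>\<^bsub>A\<^esub> inv\<^bsub>A\<^esub> a \<otimes>\<^bsub>A\<^esub> (a \<otimes>\<^bsub>M\<^esub> c)"

definition brace_lambda :: "'g monoid \<Rightarrow> 'g monoid \<Rightarrow> 'g \<Rightarrow> 'g \<Rightarrow> 'g" where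
  "brace_lambda A M a b = inv\<^bsub>A\<^esub> a \<otimes>\<^bsub>A\<^esub> (a \<otimes>\<^bsub>M\<^esub> b)"

definition brace_solution :: "'g monoid \<Rightarrow> 'g monoid \<Rightarrow> 'g \<times> 'g \<Rightarrow> 'g \<times> 'g" where
  "brace_solution A M = (\<lambda>(a, b).
    (brace_lambda A M a b, inv\<^bsub>M\<^esub> (brace_lambda A M a b) \<otimes>\<^bsub>M\<^esub> a \<otimes>\<^bsub>M\<^esub> b))"

definition is_structure_brace_add ::
    "'a set \<Rightarrow> ('a \<times> 'a \<Rightarrow> 'a \<times> 'a) \<Rightarrow> 'a gword set monoid \<Rightarrow> bool" where
  "is_structure_brace_add X r A \<longleftrightarrow>
    skew_left_brace A (structure_group X r) \<and>
    (\<forall>x\<in>X. \<forall>y\<in>X.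
      brace_solution A (structure_group X r) (structure_iota X r x, structure_iota X r y)
        = map_prod (structure_iota X r) (structure_iota X r) (r (x, y)))"

text \<open>For a non-degenerate solution such an additive group exists, and its operation is uniquely
  determined on the carrier. The description operator is \<open>SOME\<close> rather than \<open>THE\<close> because a
  \<open>monoid\<close> record also fixes irrelevant values of the operation outside the carrier.\<close>

definition structure_brace_add ::
    "'a set \<Rightarrow> ('a \<times> 'a \<Rightarrow> 'a \<times> 'a) \<Rightarrow> 'a gword set monoid" where
  "structure_brace_add X r = (SOME A. is_structure_brace_add X r A)"

definition inj_carrier :: "'a set \<Rightarrow> ('a \<times> 'a \<Rightarrow> 'a \<times> 'a) \<Rightarrow> 'a gword set set" where
  "inj_carrier X r = structure_iota X r ` X"

definition inj_map ::
    "'a set \<Rightarrow> ('a \<times> 'a \<Rightarrow> 'a \<times> 'a) \<Rightarrow> 'a gword set \<times> 'a gword set \<Rightarrow> 'a gword set \<times> 'a gword set"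
where
  "inj_map X r = restrict (brace_solution (structure_brace_add X r) (structure_group X r))
    (inj_carrier X r \<times> inj_carrier X r)"

end

(* Write s(x, y) and t(y, x) for the components of r(x, y), i for the canonical map X -> G, and
   x < y for s(y, psi_y(x)), where r(x, z) = (y, psi_y(x)) for the z with s(x, z) = y. The maps s and
   psi extend to actions of G on X, which give two commuting families of permutations of the set G:
   the future right translations h -> h + i(x) and left translations h -> i(x) + h. Both families
   act transitively, so the centralizer of the left translations is a regular permutation group,
   and transporting its composition to G yields the additive group of the skew brace. There
   i(x) + i(y) = i(y) + i(x < y), and the injectivization is involutive iff i(x < y) = i(x) for all
   x, y.

   If G is torsion-free: the common kernel K of the two actions has finite index and is central in
   the additive group, and both group operations agree on it. The element d = i(x) - i(x < y) is
   killed by all additive homomorphisms to K, hence so are its multiplicative powers. One of these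
   lies in K, where the transfer is multiplication by the index, so d is a torsion element.

   If the injectivization is involutive: the additive group is abelian, and G acts by affine
   automorphisms, monotone for the pointwise order, on the free abelian group over i(X), compatibly
   with left multiplication on G under the evaluation map. A torsion element fixes the pointwise
   maximum of the orbit of 0, so it fixes an element of G under left multiplication, and is
   trivial. *)

theory Submission
  imports Defs "HOL-Algebra.Group_Action" "HOL-Algebra.FiniteProduct"
begin

section \<open>Presented groups\<close>

lemma gwords_append: "u \<in> gwords X \<Longrightarrow> v \<in> gwords X \<Longrightarrow> u @ v \<in> gwords X"
  by (auto simp: gwords_def)

lemma gwords_Nil: "[] \<in> gwords X"
  by (simp add: gwords_def)

lemma gwords_Cons: "(x, b) # w \<in> gwords X \<longleftrightarrow> x \<in> X \<and> w \<in> gwords X"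
  by (auto simp: gwords_def)

lemma pres_rel_gwords:
  "(u, v) \<in> pres_rel X R \<Longrightarrow> u \<in> gwords X \<and> v \<in> gwords X"
  by (induction rule: pres_rel.induct) (auto simp: gwords_def)

lemma equiv_pres_rel: "equiv (gwords X) (pres_rel X R)"
proof (rule equivI)
  show "pres_rel X R \<subseteq> gwords X \<times> gwords X"
    using pres_rel_gwords by fastforce
  show "refl_on (gwords X) (pres_rel X R)"
    by (auto simp: refl_on_def intro: pres_rel.refl)
  show "sym (pres_rel X R)"
    by (auto simp: sym_def intro: pres_rel.sym)
  show "trans (pres_rel X R)"
    by (auto simp: trans_def intro: pres_rel.trans)
qed

lemma pres_rel_append_left:
  "(u, v) \<in> pres_rel X R \<Longrightarrow> w \<in> gwords X \<Longrightarrow> (w @ u, w @ v) \<in> pres_rel X R"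
proof (induction rule: pres_rel.induct)
  case (refl u)
  then show ?case by (auto intro: pres_rel.refl gwords_append)
next
  case (cancel x u v b)
  then show ?case using pres_rel.cancel[of x X "w @ u" v b R] by (simp add: gwords_append)
next
  case (relation s t u v)
  then show ?case using pres_rel.relation[of s t R X "w @ u" v] by (simp add: gwords_append)
qed (auto intro: pres_rel.sym pres_rel.trans)

lemma pres_rel_append_right:
  "(u, v) \<in> pres_rel X R \<Longrightarrow> w \<in> gwords X \<Longrightarrow> (u @ w, v @ w) \<in> pres_rel X R"
proof (induction rule: pres_rel.induct)
  case (refl u)
  then show ?case by (auto intro: pres_rel.refl gwords_append)
next
  case (cancel x u v b)
  then show ?case using pres_rel.cancel[of x X u "v @ w" b R] by (simp add: gwords_append)
next
  case (relation s t u v)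
  then show ?case using pres_rel.relation[of s t R X u "v @ w"] by (simp add: gwords_append)
qed (auto intro: pres_rel.sym pres_rel.trans)

lemma pres_rel_append:
  assumes "(u, u') \<in> pres_rel X R" "(v, v') \<in> pres_rel X R"
  shows "(u @ v, u' @ v') \<in> pres_rel X R"
  using assms pres_rel_append_left pres_rel_append_right pres_rel.trans pres_rel_gwords by metis

abbreviation word_class :: "'a set \<Rightarrow> ('a gword \<times> 'a gword) set \<Rightarrow> 'a gword \<Rightarrow> 'a gword set" where
  "word_class X R w \<equiv> pres_rel X R `` {w}"

lemma word_class_eq_iff:
  "u \<in> gwords X \<Longrightarrow> v \<in> gwords X \<Longrightarrow>
    word_class X R u = word_class X R v \<longleftrightarrow> (u, v) \<in> pres_rel X R"
  using eq_equiv_class_iff[OF equiv_pres_rel] by metis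

lemma carrier_presented_group:
  "carrier (presented_group X R) = word_class X R ` gwords X"
  by (auto simp: presented_group_def quotient_def)

lemma mult_word_class:
  assumes "u \<in> gwords X" "v \<in> gwords X"
  shows "word_class X R u \<otimes>\<^bsub>presented_group X R\<^esub> word_class X R v = word_class X R (u @ v)"
proof -
  have "pres_rel X R `` {u' @ v' | u' v'. u' \<in> word_class X R u \<and> v' \<in> word_class X R v}
      = word_class X R (u @ v)"
    (is "?L = ?R")
  proof
    show "?L \<subseteq> ?R"
      using pres_rel_append pres_rel.trans by fastforce
    show "?R \<subseteq> ?L"
      using assms by (auto intro: pres_rel.refl)
  qed
  then show ?thesis by (simp add: presented_group_def)
qed

lemma one_presented_group: "\<one>\<^bsub>presented_group X R\<^esub> = word_class X R []"
  by (simp add: presented_group_def)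

definition inverse_word :: "'a gword \<Rightarrow> 'a gword" where
  "inverse_word w = rev (map (\<lambda>(x, b). (x, \<not> b)) w)"

lemma inverse_word_gwords: "w \<in> gwords X \<Longrightarrow> inverse_word w \<in> gwords X"
  by (auto simp: gwords_def inverse_word_def in_lists_conv_set)

lemma inverse_word_cancel:
  "w \<in> gwords X \<Longrightarrow> (inverse_word w @ w, []) \<in> pres_rel X R"
proof (induction w)
  case Nil
  then show ?case by (simp add: inverse_word_def pres_rel.refl gwords_Nil)
next
  case (Cons l w)
  obtain x b where l: "l = (x, b)" by (cases l)
  have w: "w \<in> gwords X" "x \<in> X" using Cons.prems l by (auto simp: gwords_Cons)
  have "(inverse_word w @ [(x, \<not> b), (x, \<not> \<not> b)] @ w, inverse_word w @ w) \<in> pres_rel X R"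
    by (rule pres_rel.cancel) (use w inverse_word_gwords in auto)
  moreover have "inverse_word (l # w) @ l # w = inverse_word w @ [(x, \<not> b), (x, \<not> \<not> b)] @ w"
    by (simp add: inverse_word_def l)
  ultimately show ?case using Cons.IH[OF w(1)] pres_rel.trans by metis
qed

lemma group_presented_group: "group (presented_group X R)"
proof (rule groupI)
  show "\<one>\<^bsub>presented_group X R\<^esub> \<in> carrier (presented_group X R)"
    by (auto simp: one_presented_group carrier_presented_group gwords_Nil)
next
  fix x y assume "x \<in> carrier (presented_group X R)" "y \<in> carrier (presented_group X R)"
  then show "x \<otimes>\<^bsub>presented_group X R\<^esub> y \<in> carrier (presented_group X R)"
    by (auto simp: carrier_presented_group mult_word_class gwords_append)
next
  fix x y z
  assume "x \<in> carrier (presented_group X R)" "y \<in> carrier (presented_group X R)"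
    "z \<in> carrier (presented_group X R)"
  then show "x \<otimes>\<^bsub>presented_group X R\<^esub> y \<otimes>\<^bsub>presented_group X R\<^esub> z
      = x \<otimes>\<^bsub>presented_group X R\<^esub> (y \<otimes>\<^bsub>presented_group X R\<^esub> z)"
    by (auto simp: carrier_presented_group mult_word_class gwords_append)
next
  fix x assume "x \<in> carrier (presented_group X R)"
  then show "\<one>\<^bsub>presented_group X R\<^esub> \<otimes>\<^bsub>presented_group X R\<^esub> x = x"
    by (auto simp: carrier_presented_group one_presented_group mult_word_class gwords_Nil)
next
  fix x assume "x \<in> carrier (presented_group X R)"
  then obtain w where w: "w \<in> gwords X" "x = word_class X R w"
    by (auto simp: carrier_presented_group)
  have "word_class X R (inverse_word w @ w) = word_class X R []"
    using w inverse_word_cancel[OF w(1)]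
    by (subst word_class_eq_iff) (auto intro: gwords_append inverse_word_gwords gwords_Nil)
  then have "word_class X R (inverse_word w) \<otimes>\<^bsub>presented_group X R\<^esub> x = \<one>\<^bsub>presented_group X R\<^esub>"
    using w by (simp add: mult_word_class one_presented_group inverse_word_gwords)
  then show "\<exists>y\<in>carrier (presented_group X R). y \<otimes>\<^bsub>presented_group X R\<^esub> x = \<one>\<^bsub>presented_group X R\<^esub>"
    using w inverse_word_gwords by (auto simp: carrier_presented_group)
qed

abbreviation generator_class :: "'a set \<Rightarrow> ('a gword \<times> 'a gword) set \<Rightarrow> 'a \<Rightarrow> 'a gword set" where
  "generator_class X R x \<equiv> word_class X R [(x, True)]"

lemma generator_class_closed:
  "x \<in> X \<Longrightarrow> generator_class X R x \<in> carrier (presented_group X R)"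
  by (auto simp: carrier_presented_group gwords_Cons gwords_Nil)

text \<open>The step hypothesis is an equivalence so that it also covers inverse letters: right
  multiplication by the generator takes the class of \<open>w @ [(x, False)]\<close> to that of
  \<open>w\<close>, and \<open>P\<close> is carried back along it.\<close>

lemma presented_group_induct:
  assumes g: "g \<in> carrier (presented_group X R)"
    and one: "P \<one>\<^bsub>presented_group X R\<^esub>"
    and mult: "\<And>h x. h \<in> carrier (presented_group X R) \<Longrightarrow> x \<in> X \<Longrightarrow>
      P (h \<otimes>\<^bsub>presented_group X R\<^esub> generator_class X R x) \<longleftrightarrow> P h"
  shows "P g"
proof -
  have "P (word_class X R w)" if "w \<in> gwords X" for w
    using that
  proof (induction w rule: rev_induct)
    case Nil
    then show ?case using one by (simp add: one_presented_group)
  next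
    case (snoc l w)
    obtain x b where l: "l = (x, b)" by (cases l)
    have w: "w \<in> gwords X" "x \<in> X" "[l] \<in> gwords X"
      using snoc.prems l by (auto simp: gwords_def)
    show ?case
    proof (cases b)
      case True
      have "P (word_class X R w \<otimes>\<^bsub>presented_group X R\<^esub> generator_class X R x)"
        using mult[of "word_class X R w" x] w snoc.IH by (auto simp: carrier_presented_group)
      then show ?thesis using w True l by (simp add: mult_word_class)
    next
      case False
      have "(w @ [(x, False), (x, \<not> False)] @ [], w @ []) \<in> pres_rel X R"
        by (rule pres_rel.cancel) (use w gwords_Nil in auto)
      then have "word_class X R ((w @ [l]) @ [(x, True)]) = word_class X R w"
        using w l False by (subst word_class_eq_iff) (auto simp: gwords_def)
      then have "word_class X R (w @ [l]) \<otimes>\<^bsub>presented_group X R\<^esub> generator_class X R x = word_class X R w"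
        using w by (simp add: mult_word_class gwords_append gwords_Cons gwords_Nil)
      then show ?thesis
        using mult[of "word_class X R (w @ [l])" x] w snoc.IH snoc.prems
        by (auto simp: carrier_presented_group)
    qed
  qed
  then show ?thesis using g by (auto simp: carrier_presented_group)
qed

section \<open>Homomorphisms out of a presented group\<close>

definition word_value :: "('h, 'm) monoid_scheme \<Rightarrow> ('a \<Rightarrow> 'h) \<Rightarrow> 'a gword \<Rightarrow> 'h" where
  "word_value H f w =
    foldr (\<lambda>(x, b) a. (if b then f x else inv\<^bsub>H\<^esub> (f x)) \<otimes>\<^bsub>H\<^esub> a) w \<one>\<^bsub>H\<^esub>"

context group
begin

lemma word_value_closed:
  "f \<in> X \<rightarrow> carrier G \<Longrightarrow> w \<in> gwords X \<Longrightarrow> word_value G f w \<in> carrier G"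
  by (induction w) (auto simp: word_value_def gwords_def Pi_def)

lemma word_value_append:
  assumes f: "f \<in> X \<rightarrow> carrier G" and "u \<in> gwords X" "v \<in> gwords X"
  shows "word_value G f (u @ v) = word_value G f u \<otimes> word_value G f v"
  using assms(2)
proof (induction u)
  case Nil
  then show ?case using word_value_closed[OF f assms(3)] by (simp add: word_value_def)
next
  case (Cons l u)
  obtain x b where l: "l = (x, b)" by (cases l)
  have u: "x \<in> X" "u \<in> gwords X" using Cons.prems l by (auto simp: gwords_Cons)
  then have "f x \<in> carrier G" using f by auto
  then show ?case
    using Cons.IH u l word_value_closed[OF f assms(3)] word_value_closed[OF f u(2)]
    by (auto simp: word_value_def m_assoc)
qed

lemma word_value_pres_rel:
  assumes f: "f \<in> X \<rightarrow> carrier G"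
    and R: "\<And>s t. (s, t) \<in> R \<Longrightarrow> s \<in> gwords X \<Longrightarrow> t \<in> gwords X \<Longrightarrow>
      word_value G f s = word_value G f t"
    and "(u, v) \<in> pres_rel X R"
  shows "word_value G f u = word_value G f v"
  using assms(3)
proof (induction rule: pres_rel.induct)
  case (cancel x u v b)
  have "f x \<in> carrier G" using f cancel by auto
  then have "word_value G f [(x, b), (x, \<not> b)] = \<one>"
    by (cases b) (auto simp: word_value_def)
  moreover have "[(x, b), (x, \<not> b)] \<in> gwords X" using cancel by (auto simp: gwords_def)
  ultimately show ?case
    using cancel by (simp add: word_value_append[OF f] word_value_closed[OF f] gwords_append
      del: append_Cons)
next
  case (relation s t u v)
  then show ?case by (simp add: word_value_append[OF f] gwords_append R)
qed auto

text \<open>Von Dyck's theorem. The homomorphism evaluates an arbitrary representative of a class;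
  \<open>word_value_pres_rel\<close> makes the result independent of the choice.\<close>

lemma presented_group_universal:
  assumes f: "f \<in> X \<rightarrow> carrier G"
    and R: "\<And>s t. (s, t) \<in> R \<Longrightarrow> s \<in> gwords X \<Longrightarrow> t \<in> gwords X \<Longrightarrow>
      word_value G f s = word_value G f t"
  shows "\<exists>\<phi> \<in> hom (presented_group X R) G. \<forall>x\<in>X. \<phi> (generator_class X R x) = f x"
proof -
  define \<phi> where "\<phi> A = word_value G f (SOME w. w \<in> A)" for A
  have \<phi>: "\<phi> (word_class X R w) = word_value G f w" if "w \<in> gwords X" for w
  proof -
    have "w \<in> word_class X R w" using that by (auto intro: pres_rel.refl)
    then have "(w, SOME w'. w' \<in> word_class X R w) \<in> pres_rel X R"
      by (metis Image_singleton_iff someI)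
    then show ?thesis unfolding \<phi>_def using word_value_pres_rel[OF f R] by metis
  qed
  have "\<phi> \<in> hom (presented_group X R) G"
    by (rule homI)
      (auto simp: carrier_presented_group mult_word_class \<phi> gwords_append
        word_value_append[OF f] word_value_closed[OF f])
  moreover have "\<phi> (generator_class X R x) = f x" if "x \<in> X" for x
    using that funcset_mem[OF f that] by (subst \<phi>) (auto simp: word_value_def gwords_def)
  ultimately show ?thesis by blast
qed

end

section \<open>Non-degenerate solutions and their structure group\<close>

locale finite_nondegenerate_solution = nondegenerate_solution +
  assumes finite_X: "finite X"
begin

abbreviation \<sigma> :: "'a \<Rightarrow> 'a \<Rightarrow> 'a" where "\<sigma> \<equiv> ybe_sigma r"
abbreviation \<tau> :: "'a \<Rightarrow> 'a \<Rightarrow> 'a" where "\<tau> \<equiv> ybe_tau r"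

lemma r_eq: "r (x, y) = (\<sigma> x y, \<tau> y x)"
  by (simp add: ybe_sigma_def ybe_tau_def)

lemma sigma_closed [simp]: "x \<in> X \<Longrightarrow> y \<in> X \<Longrightarrow> \<sigma> x y \<in> X"
  using sigma_bij bij_betwE by metis

lemma tau_closed [simp]: "x \<in> X \<Longrightarrow> y \<in> X \<Longrightarrow> \<tau> x y \<in> X"
  using tau_bij bij_betwE by metis

lemma tau_inject: "x \<in> X \<Longrightarrow> y \<in> X \<Longrightarrow> z \<in> X \<Longrightarrow> \<tau> x y = \<tau> x z \<longleftrightarrow> y = z"
  using tau_bij[of x] by (auto simp: bij_betw_def inj_on_def)

lemma sigma_surj: "x \<in> X \<Longrightarrow> y \<in> X \<Longrightarrow> \<exists>z\<in>X. \<sigma> x z = y"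
  using bij_betw_imp_surj_on[OF sigma_bij[of x]] by (metis imageE)

lemma tau_surj: "x \<in> X \<Longrightarrow> y \<in> X \<Longrightarrow> \<exists>z\<in>X. \<tau> x z = y"
  using bij_betw_imp_surj_on[OF tau_bij[of x]] by (metis imageE)

text \<open>These are the three coordinates of \<open>braid\<close> at the triple
  \<open>(x, y, z)\<close>, in this order.\<close>

lemma
  assumes "x \<in> X" "y \<in> X" "z \<in> X"
  shows braid_sigma: "\<sigma> (\<sigma> x y) (\<sigma> (\<tau> y x) z) = \<sigma> x (\<sigma> y z)"
    and braid_mixed: "\<tau> (\<sigma> (\<tau> y x) z) (\<sigma> x y) = \<sigma> (\<tau> (\<sigma> y z) x) (\<tau> z y)"
    and braid_tau: "\<tau> z (\<tau> y x) = \<tau> (\<tau> z y) (\<tau> (\<sigma> y z) x)"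
  using braid[of "(x, y, z)"] assms by (auto simp: ybe_r1_def ybe_r2_def r_eq)

text \<open>In the skew brace on the structure group, \<open>\<psi> y x\<close> corresponds to
  \<open>\<lambda>\<^sub>y\<inverse> (- y + x + y)\<close>.\<close>

definition \<psi> :: "'a \<Rightarrow> 'a \<Rightarrow> 'a" where
  "\<psi> y x = \<tau> (inv_into X (\<sigma> x) y) x"

lemma psi_sigma: "x \<in> X \<Longrightarrow> z \<in> X \<Longrightarrow> \<psi> (\<sigma> x z) x = \<tau> z x"
  using sigma_bij[of x] by (simp add: \<psi>_def bij_betw_def)

lemma psi_closed [simp]: "x \<in> X \<Longrightarrow> y \<in> X \<Longrightarrow> \<psi> y x \<in> X"
  using psi_sigma tau_closed sigma_surj[of x y] by auto

text \<open>The element \<open>x\<close> is the first coordinate of the preimage of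
  \<open>(y, \<psi> y x)\<close> under \<open>r\<close>, and \<open>r\<close> is injective.\<close>

lemma psi_inject:
  assumes "y \<in> X" "x \<in> X" "x' \<in> X" "\<psi> y x = \<psi> y x'"
  shows "x = x'"
proof -
  obtain z where z: "z \<in> X" "\<sigma> x z = y" using sigma_surj assms by metis
  obtain z' where z': "z' \<in> X" "\<sigma> x' z' = y" using sigma_surj assms by metis
  have "r (x, z) = r (x', z')"
    using z z' psi_sigma[of x z] psi_sigma[of x' z'] assms by (simp add: r_eq)
  moreover have "inj_on r (X \<times> X)" using bijective by (simp add: bij_betw_def)
  ultimately show ?thesis
    using assms z z' by (metis Pair_inject inj_onD mem_Sigma_iff)
qed

lemma psi_bij: assumes y: "y \<in> X" shows "bij_betw (\<psi> y) X X"
proof -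
  have inj: "inj_on (\<psi> y) X" using psi_inject[OF y] by (meson inj_onI)
  have "\<psi> y ` X = X" by (rule endo_inj_surj[OF finite_X _ inj]) (use y in auto)
  with inj show ?thesis by (simp add: bij_betw_def)
qed

text \<open>This is the braid relation at \<open>(c, p, q)\<close>, where
  \<open>\<sigma> c p = x\<close> and \<open>\<sigma> (\<psi> x c) q = y\<close>: its first two
  coordinates identify the subscripts, its third gives the equality.\<close>

lemma psi_braid:
  assumes "x \<in> X" "y \<in> X" "c \<in> X"
  shows "\<psi> y (\<psi> x c) = \<psi> (\<tau> y x) (\<psi> (\<sigma> x y) c)"
proof -
  obtain p where p: "p \<in> X" "\<sigma> c p = x" using sigma_surj assms by metis
  define d where "d = \<tau> p c"
  have d: "d \<in> X" "\<psi> x c = d" using p assms psi_sigma[of c p] by (auto simp: d_def)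
  obtain q where q: "q \<in> X" "\<sigma> d q = y" using sigma_surj assms d by metis
  have "\<sigma> c (\<sigma> p q) = \<sigma> x y" "\<tau> y x = \<sigma> (\<tau> (\<sigma> p q) c) (\<tau> q p)"
    "\<tau> q d = \<tau> (\<tau> q p) (\<tau> (\<sigma> p q) c)"
    using braid_sigma[of c p q] braid_mixed[of c p q] braid_tau[of c p q] p q assms
    by (auto simp: d_def)
  then show ?thesis
    using psi_sigma[of d q] psi_sigma[of c "\<sigma> p q"] psi_sigma[of "\<tau> (\<sigma> p q) c" "\<tau> q p"]
      p q d assms by simp
qed

text \<open>With \<open>w = \<psi> y y\<close> one finds \<open>\<tau> w y = w\<close>, so
  \<open>y\<close> is recovered from \<open>w\<close> because \<open>\<tau> w\<close> is injective.
  The diagonal map controls the invertibility of \<open>L\<close>.\<close>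

lemma psi_diagonal_inj: "inj_on (\<lambda>y. \<psi> y y) X"
proof (rule inj_onI)
  have fixed: "\<tau> (\<psi> y y) y = \<psi> y y" if y: "y \<in> X" for y
  proof -
    obtain z where z: "z \<in> X" "\<sigma> y z = y" using sigma_surj y by metis
    have w: "\<psi> y y = \<tau> z y" using psi_sigma[of y z] z y by simp
    \<comment> \<open>Together with \<open>\<sigma> y z = y\<close>, this choice of \<open>x\<close>
      collapses the third braid coordinate at \<open>(x, y, z)\<close> to the claim.\<close>
    obtain x where x: "x \<in> X" "\<tau> y x = y" using tau_surj y by metis
    show ?thesis using braid_tau[OF x(1) y z(1)] unfolding x(2) z(2) w by (rule HOL.sym)
  qed
  fix y y' assume "y \<in> X" "y' \<in> X" "\<psi> y y = \<psi> y' y'"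
  then show "y = y'" using fixed tau_inject psi_closed by metis
qed

lemma psi_diagonal_surj: assumes "w \<in> X" shows "\<exists>y\<in>X. \<psi> y y = w"
proof -
  have "(\<lambda>y. \<psi> y y) ` X = X"
    by (rule endo_inj_surj[OF finite_X _ psi_diagonal_inj]) auto
  then show ?thesis using assms by (metis (no_types, lifting) imageE)
qed

text \<open>The first braid coordinate at \<open>(b, w, t)\<close>, with
  \<open>\<tau> w b = w\<close> and \<open>\<sigma> w t = w\<close>, makes
  \<open>c = \<sigma> b w\<close> a solution.\<close>

lemma sigma_diagonal_surj: assumes "w \<in> X" shows "\<exists>c\<in>X. \<sigma> c w = c"
proof -
  obtain b where b: "b \<in> X" "\<tau> w b = w" using tau_surj assms by metis
  obtain t where t: "t \<in> X" "\<sigma> w t = w" using sigma_surj assms by metis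
  have "\<sigma> (\<sigma> b w) w = \<sigma> b w" using braid_sigma[of b w t] b t assms by simp
  then show ?thesis using b assms by (metis sigma_closed)
qed

text \<open>The \<open>w\<close> belonging to \<open>c\<close> is the preimage of \<open>c\<close>
  under \<open>\<sigma> c\<close>. The resulting self-map of \<open>X\<close> is onto by
  \<open>sigma_diagonal_surj\<close>, hence injective since \<open>X\<close> is finite.\<close>

lemma sigma_diagonal_inject:
  assumes "c \<in> X" "c' \<in> X" "w \<in> X" "\<sigma> c w = c" "\<sigma> c' w = c'"
  shows "c = c'"
proof -
  define f where "f = (\<lambda>c. inv_into X (\<sigma> c) c)"
  have f: "f c = w" if "c \<in> X" "w \<in> X" "\<sigma> c w = c" for c w
    using that sigma_bij[of c] by (metis bij_betw_inv_into_left f_def)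
  have "X \<subseteq> f ` X"
  proof
    fix w assume "w \<in> X"
    then obtain c where "c \<in> X" "\<sigma> c w = c" using sigma_diagonal_surj by metis
    then show "w \<in> f ` X" using f \<open>w \<in> X\<close> by force
  qed
  then have "f ` X = X"
    using finite_X by (metis card_image_le card_seteq finite_imageI)
  then have "inj_on f X" using finite_X eq_card_imp_inj_on by metis
  moreover have "f c = f c'" using f assms by metis
  ultimately show ?thesis using assms by (auto dest: inj_onD)
qed

section \<open>The structure group and its universal property\<close>

definition G :: "'a gword set monoid" where "G = structure_group X r"
definition \<iota> :: "'a \<Rightarrow> 'a gword set" where "\<iota> = structure_iota X r"

lemma iota_eq: "\<iota> x = generator_class X (structure_relations X r) x"
  by (simp add: \<iota>_def structure_iota_def)

sublocale group G
  by (simp add: G_def structure_group_def group_presented_group)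

lemma iota_closed [simp]: "x \<in> X \<Longrightarrow> \<iota> x \<in> carrier G"
  by (simp add: iota_eq G_def structure_group_def generator_class_closed)

lemma iota_braid:
  assumes "x \<in> X" "y \<in> X"
  shows "\<iota> x \<otimes>\<^bsub>G\<^esub> \<iota> y = \<iota> (\<sigma> x y) \<otimes>\<^bsub>G\<^esub> \<iota> (\<tau> y x)"
proof -
  let ?R = "structure_relations X r"
  have "([] @ [(x, True), (y, True)] @ [], [] @ [(\<sigma> x y, True), (\<tau> y x, True)] @ []) \<in> pres_rel X ?R"
    by (rule pres_rel.relation) (use assms in \<open>auto simp: structure_relations_def gwords_def\<close>)
  then have "word_class X ?R [(x, True), (y, True)] = word_class X ?R [(\<sigma> x y, True), (\<tau> y x, True)]"
    using assms by (subst word_class_eq_iff) (auto simp: gwords_def)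
  then show ?thesis
    using assms by (simp add: iota_eq G_def structure_group_def mult_word_class gwords_def)
qed

lemma structure_group_induct [consumes 1, case_names one mult]:
  assumes "g \<in> carrier G" "P \<one>\<^bsub>G\<^esub>"
    "\<And>h x. h \<in> carrier G \<Longrightarrow> x \<in> X \<Longrightarrow> P (h \<otimes>\<^bsub>G\<^esub> \<iota> x) \<longleftrightarrow> P h"
  shows "P g"
  using assms unfolding iota_eq G_def structure_group_def by (rule presented_group_induct)

lemma structure_group_universal:
  assumes H: "group H" and f: "f \<in> X \<rightarrow> carrier H"
    and rel: "\<And>x y. x \<in> X \<Longrightarrow> y \<in> X \<Longrightarrow> f x \<otimes>\<^bsub>H\<^esub> f y = f (\<sigma> x y) \<otimes>\<^bsub>H\<^esub> f (\<tau> y x)"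
  shows "\<exists>\<phi> \<in> hom G H. \<forall>x\<in>X. \<phi> (\<iota> x) = f x"
proof -
  interpret H: group H by fact
  have fH: "f x \<in> carrier H" if "x \<in> X" for x using f that by auto
  have "word_value H f s = word_value H f t"
    if st: "(s, t) \<in> structure_relations X r" for s t
  proof -
    obtain x y where "x \<in> X" "y \<in> X" "s = [(x, True), (y, True)]"
      "t = [(\<sigma> x y, True), (\<tau> y x, True)]"
      using st unfolding structure_relations_def by blast
    then show ?thesis using rel[of x y] fH by (simp add: word_value_def)
  qed
  from H.presented_group_universal[OF f this] show ?thesis
    by (simp add: iota_eq G_def structure_group_def)
qed

text \<open>The universal property is applied with the group of permutations of \<open>S\<close> as
  target.\<close>

lemma structure_group_action:
  assumes bij: "\<And>x. x \<in> X \<Longrightarrow> bij_betw (f x) S S"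
    and rel: "\<And>x y s. x \<in> X \<Longrightarrow> y \<in> X \<Longrightarrow> s \<in> S \<Longrightarrow>
      f x (f y s) = f (\<sigma> x y) (f (\<tau> y x) s)"
  shows "\<exists>\<phi>. group_action G S \<phi> \<and> (\<forall>x\<in>X. \<forall>s\<in>S. \<phi> (\<iota> x) s = f x s)"
proof -
  \<comment> \<open>Elements of \<open>Bij S\<close> are extensional, so \<open>f x\<close> has to
    be restricted to \<open>S\<close>.\<close>
  define f' where "f' x = restrict (f x) S" for x
  have f': "f' x \<in> Bij S" if "x \<in> X" for x
    using bij[OF that] by (simp add: f'_def Bij_def)
  have comp: "compose S (f' x) (f' y) = compose S (f' (\<sigma> x y)) (f' (\<tau> y x))"
    if "x \<in> X" "y \<in> X" for x y
  proof
    fix s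
    show "compose S (f' x) (f' y) s = compose S (f' (\<sigma> x y)) (f' (\<tau> y x)) s"
      using rel[OF that] bij_betwE[OF bij[of y]] bij_betwE[OF bij[of "\<tau> y x"]] that
      by (simp add: compose_def f'_def)
  qed
  have "f' x \<otimes>\<^bsub>BijGroup S\<^esub> f' y = f' (\<sigma> x y) \<otimes>\<^bsub>BijGroup S\<^esub> f' (\<tau> y x)"
    if "x \<in> X" "y \<in> X" for x y
    using comp[OF that] f' that by (simp add: BijGroup_def)
  moreover have "f' \<in> X \<rightarrow> carrier (BijGroup S)"
    using f' by (simp add: BijGroup_def)
  ultimately obtain \<phi> where \<phi>: "\<phi> \<in> hom G (BijGroup S)" "\<forall>x\<in>X. \<phi> (\<iota> x) = f' x"
    using structure_group_universal[OF group_BijGroup] by blast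
  have "group_action G S \<phi>"
    using \<phi>(1) group_BijGroup is_group
    by (auto simp: group_action_def group_hom_def group_hom_axioms_def)
  then show ?thesis using \<phi>(2) by (auto simp: f'_def)
qed

end

section \<open>The skew brace structure on the structure group\<close>

context finite_nondegenerate_solution
begin

abbreviation gmult (infixl "\<cdot>" 70) where "a \<cdot> b \<equiv> a \<otimes>\<^bsub>G\<^esub> b"

section \<open>The two actions of the structure group on \<open>X\<close>\<close>

definition lam :: "'a gword set \<Rightarrow> 'a \<Rightarrow> 'a" where
  "lam = (SOME \<phi>. group_action G X \<phi> \<and> (\<forall>x\<in>X. \<forall>s\<in>X. \<phi> (\<iota> x) s = \<sigma> x s))"

text \<open>\<open>braid_sigma\<close> says exactly that the permutations \<open>\<sigma> x\<close>
  satisfy the relations of \<open>G\<close>.\<close>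

lemma lam_action: "group_action G X lam \<and> (\<forall>x\<in>X. \<forall>s\<in>X. lam (\<iota> x) s = \<sigma> x s)"
  unfolding lam_def
  by (rule someI_ex[OF structure_group_action[OF sigma_bij braid_sigma[symmetric]]])

text \<open>As \<open>x \<mapsto> \<psi> x\<close> is an anti-homomorphism, only the inverses of the \<open>\<psi> x\<close> give a left action.\<close>

definition rho :: "'a gword set \<Rightarrow> 'a \<Rightarrow> 'a" where
  "rho = (SOME \<phi>. group_action G X \<phi> \<and>
    (\<forall>x\<in>X. \<forall>s\<in>X. \<phi> (\<iota> x) s = inv_into X (\<psi> x) s))"

lemma inv_psi_eq_iff:
  "y \<in> X \<Longrightarrow> s \<in> X \<Longrightarrow> t \<in> X \<Longrightarrow> inv_into X (\<psi> y) s = t \<longleftrightarrow> \<psi> y t = s"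
  using psi_bij[of y] by (metis bij_betw_inv_into_left bij_betw_inv_into_right)

lemma inv_psi_closed: "y \<in> X \<Longrightarrow> s \<in> X \<Longrightarrow> inv_into X (\<psi> y) s \<in> X"
  using psi_bij[of y] by (metis bij_betwE bij_betw_inv_into)

text \<open>Inverting both sides of \<open>psi_braid\<close> gives the relations of \<open>G\<close>
  for the maps \<open>inv_into X (\<psi> x)\<close>.\<close>

lemma rho_action:
  "group_action G X rho \<and> (\<forall>x\<in>X. \<forall>s\<in>X. rho (\<iota> x) s = inv_into X (\<psi> x) s)"
proof -
  have "inv_into X (\<psi> x) (inv_into X (\<psi> y) s)
      = inv_into X (\<psi> (\<sigma> x y)) (inv_into X (\<psi> (\<tau> y x)) s)"
    if xy: "x \<in> X" "y \<in> X" "s \<in> X" for x y s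
  proof -
    define t where "t = inv_into X (\<psi> (\<sigma> x y)) (inv_into X (\<psi> (\<tau> y x)) s)"
    have t: "t \<in> X" using xy by (simp add: t_def inv_psi_closed)
    have 1: "\<psi> (\<sigma> x y) t = inv_into X (\<psi> (\<tau> y x)) s"
      unfolding t_def by (rule bij_betw_inv_into_right[OF psi_bij]) (use xy inv_psi_closed in auto)
    have "\<psi> (\<tau> y x) (\<psi> (\<sigma> x y) t) = s"
      unfolding 1 by (rule bij_betw_inv_into_right[OF psi_bij]) (use xy in auto)
    then have "\<psi> y (\<psi> x t) = s" unfolding psi_braid[OF xy(1,2) t] .
    then have "inv_into X (\<psi> y) s = \<psi> x t"
      using inv_psi_eq_iff[of y s "\<psi> x t"] xy t by simp
    then have "inv_into X (\<psi> x) (inv_into X (\<psi> y) s) = t"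
      using inv_psi_eq_iff[of x "\<psi> x t" t] xy t by simp
    then show ?thesis by (simp add: t_def)
  qed
  note rel = this
  show ?thesis
    unfolding rho_def
    by (rule someI_ex[OF structure_group_action[OF bij_betw_inv_into[OF psi_bij] rel]])
qed

sublocale lam: group_action G X lam using lam_action by simp
sublocale rho: group_action G X rho using rho_action by simp

lemma lam_iota: "x \<in> X \<Longrightarrow> s \<in> X \<Longrightarrow> lam (\<iota> x) s = \<sigma> x s"
  using lam_action by blast

lemma lam_closed [simp]: "g \<in> carrier G \<Longrightarrow> x \<in> X \<Longrightarrow> lam g x \<in> X"
  using lam.element_image by blast

lemma rho_closed [simp]: "g \<in> carrier G \<Longrightarrow> x \<in> X \<Longrightarrow> rho g x \<in> X"
  using rho.element_image by blast

lemma lam_one: "x \<in> X \<Longrightarrow> lam \<one>\<^bsub>G\<^esub> x = x"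
  by (metis lam.id_eq_one restrict_apply')

lemma rho_one: "x \<in> X \<Longrightarrow> rho \<one>\<^bsub>G\<^esub> x = x"
  by (metis rho.id_eq_one restrict_apply')

lemma lam_inv_lam: "g \<in> carrier G \<Longrightarrow> x \<in> X \<Longrightarrow> lam (inv\<^bsub>G\<^esub> g) (lam g x) = x"
  using lam.orbit_sym_aux by blast

lemma lam_lam_inv: "g \<in> carrier G \<Longrightarrow> x \<in> X \<Longrightarrow> lam g (lam (inv\<^bsub>G\<^esub> g) x) = x"
  using lam_inv_lam[of "inv\<^bsub>G\<^esub> g" x] by simp

lemma rho_inv_rho: "g \<in> carrier G \<Longrightarrow> x \<in> X \<Longrightarrow> rho (inv\<^bsub>G\<^esub> g) (rho g x) = x"
  using rho.orbit_sym_aux by blast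

lemma rho_inv_iota:
  assumes "x \<in> X" "s \<in> X" shows "rho (inv\<^bsub>G\<^esub> (\<iota> x)) s = \<psi> x s"
proof -
  have "rho (\<iota> x) (\<psi> x s) = s" using rho_action assms inv_psi_eq_iff by simp
  then show ?thesis using rho_inv_rho[of "\<iota> x" "\<psi> x s"] assms by simp
qed

text \<open>Inversion turns \<open>rho\<close> back into the anti-action: appending
  \<open>\<iota> y\<close> to \<open>h\<close> applies \<open>\<psi> y\<close> last.\<close>

lemma rho_inv_mult_iota:
  assumes "h \<in> carrier G" "x \<in> X" "y \<in> X"
  shows "rho (inv\<^bsub>G\<^esub> (h \<cdot> \<iota> y)) x = \<psi> y (rho (inv\<^bsub>G\<^esub> h) x)"
  using assms by (simp add: inv_mult_group rho.composition_rule rho_inv_iota)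

lemma lam_inv_mult_iota:
  assumes "h \<in> carrier G" "x \<in> X" "y \<in> X"
  shows "\<sigma> y (lam (inv\<^bsub>G\<^esub> (h \<cdot> \<iota> y)) x) = lam (inv\<^bsub>G\<^esub> h) x"
proof -
  have "lam (inv\<^bsub>G\<^esub> (h \<cdot> \<iota> y)) x = lam (inv\<^bsub>G\<^esub> (\<iota> y)) (lam (inv\<^bsub>G\<^esub> h) x)"
    using assms by (simp add: inv_mult_group lam.composition_rule)
  then show ?thesis
    using lam_lam_inv[of "\<iota> y" "lam (inv\<^bsub>G\<^esub> h) x"] lam_iota assms by simp
qed

text \<open>Right and left additive translation by the generator \<open>\<iota> x\<close>.\<close>

definition T :: "'a \<Rightarrow> 'a gword set \<Rightarrow> 'a gword set" where
  "T x h = h \<cdot> \<iota> (lam (inv\<^bsub>G\<^esub> h) x)"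

definition L :: "'a \<Rightarrow> 'a gword set \<Rightarrow> 'a gword set" where
  "L x h = h \<cdot> \<iota> (rho (inv\<^bsub>G\<^esub> h) x)"

lemma T_closed [simp]: "x \<in> X \<Longrightarrow> h \<in> carrier G \<Longrightarrow> T x h \<in> carrier G"
  by (simp add: T_def)

lemma L_closed [simp]: "x \<in> X \<Longrightarrow> h \<in> carrier G \<Longrightarrow> L x h \<in> carrier G"
  by (simp add: L_def)

text \<open>Both sides are \<open>h\<close> times a product of two generators. If \<open>L\<close>
  comes first, these belong to \<open>a\<close> and to some \<open>c\<close> with
  \<open>\<sigma> a c = b\<close>; otherwise to \<open>b\<close> and \<open>\<psi> b a\<close>.
  Since \<open>r (a, c) = (b, \<psi> b a)\<close>, a defining relation identifies the
  products.\<close>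

lemma T_L_commute:
  assumes "x \<in> X" "y \<in> X" "h \<in> carrier G"
  shows "T x (L y h) = L y (T x h)"
proof -
  define a b where "a = rho (inv\<^bsub>G\<^esub> h) y" and "b = lam (inv\<^bsub>G\<^esub> h) x"
  have ab: "a \<in> X" "b \<in> X" using assms by (auto simp: a_def b_def)
  define c where "c = lam (inv\<^bsub>G\<^esub> (h \<cdot> \<iota> a)) x"
  have c: "c \<in> X" "\<sigma> a c = b"
    using lam_inv_mult_iota[of h x a] assms ab by (auto simp: c_def b_def)
  have "T x (L y h) = h \<cdot> (\<iota> a \<cdot> \<iota> c)"
    using assms ab c by (simp add: T_def L_def a_def[symmetric] c_def[symmetric] m_assoc)
  moreover have "L y (T x h) = h \<cdot> (\<iota> b \<cdot> \<iota> (\<psi> b a))"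
    using assms ab rho_inv_mult_iota[of h y b]
    by (simp add: T_def L_def a_def[symmetric] b_def[symmetric] m_assoc)
  moreover have "\<iota> a \<cdot> \<iota> c = \<iota> b \<cdot> \<iota> (\<psi> b a)"
    using iota_braid[of a c] psi_sigma[of a c] ab c by simp
  ultimately show ?thesis by simp
qed

text \<open>Solving \<open>L x h = k\<close> means writing \<open>k = h \<cdot> \<iota> y\<close>
  with \<open>y = rho (inv h) x\<close>, which amounts to \<open>\<psi> y y = rho (inv k) x\<close>.
  The diagonal map of \<open>\<psi>\<close> is a bijection of \<open>X\<close>, so there is exactly
  one such \<open>y\<close>.\<close>

lemma L_bij: assumes x: "x \<in> X" shows "bij_betw (L x) (carrier G) (carrier G)"
proof (rule bij_betw_imageI)
  show "inj_on (L x) (carrier G)"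
  proof (rule inj_onI)
    fix h h' assume h: "h \<in> carrier G" "h' \<in> carrier G" "L x h = L x h'"
    define y y' where "y = rho (inv\<^bsub>G\<^esub> h) x" and "y' = rho (inv\<^bsub>G\<^esub> h') x"
    have y: "y \<in> X" "y' \<in> X" using x h by (auto simp: y_def y'_def)
    have k: "h \<cdot> \<iota> y = h' \<cdot> \<iota> y'" using h by (simp add: L_def y_def y'_def)
    have "\<psi> y y = \<psi> y' y'"
      using rho_inv_mult_iota[OF h(1) x y(1)] rho_inv_mult_iota[OF h(2) x y(2)]
      unfolding y_def[symmetric] y'_def[symmetric] k by simp
    then have "y = y'" using inj_onD[OF psi_diagonal_inj] y by blast
    then show "h = h'" using k h y by (metis iota_closed right_cancel)
  qed
  show "L x ` carrier G = carrier G"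
  proof
    show "L x ` carrier G \<subseteq> carrier G" using x by auto
    show "carrier G \<subseteq> L x ` carrier G"
    proof
      fix k assume k: "k \<in> carrier G"
      obtain y where y: "y \<in> X" "\<psi> y y = rho (inv\<^bsub>G\<^esub> k) x"
        using psi_diagonal_surj[of "rho (inv\<^bsub>G\<^esub> k) x"] x k by auto
      define h where "h = k \<cdot> inv\<^bsub>G\<^esub> (\<iota> y)"
      have h: "h \<in> carrier G" "h \<cdot> \<iota> y = k" using k y by (auto simp: h_def m_assoc)
      have "\<psi> y (rho (inv\<^bsub>G\<^esub> h) x) = \<psi> y y"
        using rho_inv_mult_iota[OF h(1) x y(1)] unfolding h(2) y(2)[symmetric] by (rule HOL.sym)
      then have "rho (inv\<^bsub>G\<^esub> h) x = y" by (rule psi_inject[rotated 3]) (use x y h in auto)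
      then have "L x h = k" using h by (simp add: L_def)
      then show "k \<in> L x ` carrier G" using h by blast
    qed
  qed
qed

text \<open>As for \<open>L\<close>, the equation \<open>T x h = k\<close> reduces to a diagonal
  one: \<open>\<sigma> y w = y\<close> with \<open>w = lam (inv k) x\<close>, which has a unique
  solution \<open>y\<close>.\<close>

lemma T_bij: assumes x: "x \<in> X" shows "bij_betw (T x) (carrier G) (carrier G)"
proof (rule bij_betw_imageI)
  show "inj_on (T x) (carrier G)"
  proof (rule inj_onI)
    fix h h' assume h: "h \<in> carrier G" "h' \<in> carrier G" "T x h = T x h'"
    define y y' where "y = lam (inv\<^bsub>G\<^esub> h) x" and "y' = lam (inv\<^bsub>G\<^esub> h') x"
    have y: "y \<in> X" "y' \<in> X" using x h by (auto simp: y_def y'_def)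
    have k: "h \<cdot> \<iota> y = h' \<cdot> \<iota> y'" using h by (simp add: T_def y_def y'_def)
    define w where "w = lam (inv\<^bsub>G\<^esub> (h' \<cdot> \<iota> y')) x"
    have w: "w \<in> X" using x h y by (simp add: w_def)
    have "\<sigma> y w = y" "\<sigma> y' w = y'"
      using lam_inv_mult_iota[OF h(1) x y(1)] lam_inv_mult_iota[OF h(2) x y(2)]
      unfolding y_def[symmetric] y'_def[symmetric] k w_def[symmetric] by auto
    then have "y = y'" using sigma_diagonal_inject y w by blast
    then show "h = h'" using k h y by (metis iota_closed right_cancel)
  qed
  show "T x ` carrier G = carrier G"
  proof
    show "T x ` carrier G \<subseteq> carrier G" using x by auto
    show "carrier G \<subseteq> T x ` carrier G"
    proof
      fix k assume k: "k \<in> carrier G"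
      define w where "w = lam (inv\<^bsub>G\<^esub> k) x"
      have w: "w \<in> X" using x k by (simp add: w_def)
      obtain c where c: "c \<in> X" "\<sigma> c w = c" using sigma_diagonal_surj[OF w] by blast
      define h where "h = k \<cdot> inv\<^bsub>G\<^esub> (\<iota> c)"
      have h: "h \<in> carrier G" "h \<cdot> \<iota> c = k" using k c by (auto simp: h_def m_assoc)
      then have "\<sigma> c w = lam (inv\<^bsub>G\<^esub> h) x"
        using lam_inv_mult_iota[of h x c] x c by (simp add: w_def)
      then have "T x h = k" using h c by (simp add: T_def)
      then show "k \<in> T x ` carrier G" using h by blast
    qed
  qed
qed

lemma T_inject: "x \<in> X \<Longrightarrow> h \<in> carrier G \<Longrightarrow> k \<in> carrier G \<Longrightarrow> T x h = T x k \<longleftrightarrow> h = k"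
  using T_bij[of x] by (auto simp: bij_betw_def inj_on_def)

lemma L_inject: "x \<in> X \<Longrightarrow> h \<in> carrier G \<Longrightarrow> k \<in> carrier G \<Longrightarrow> L x h = L x k \<longleftrightarrow> h = k"
  using L_bij[of x] by (auto simp: bij_betw_def inj_on_def)

text \<open>At \<open>h\<close>, right multiplication by \<open>\<iota> x\<close> coincides with
  \<open>T (lam h x)\<close>, so the \<open>T x\<close> and their inverses act transitively on
  \<open>G\<close>; the rule expresses this transitivity.\<close>

lemma T_induct [consumes 1, case_names one T]:
  assumes "g \<in> carrier G" "P \<one>\<^bsub>G\<^esub>"
    and T: "\<And>h x. h \<in> carrier G \<Longrightarrow> x \<in> X \<Longrightarrow> P (T x h) \<longleftrightarrow> P h"
  shows "P g"
  using assms(1,2)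
proof (rule structure_group_induct)
  fix h x assume h: "h \<in> carrier G" "x \<in> X"
  have "h \<cdot> \<iota> x = T (lam h x) h" using h by (simp add: T_def lam_inv_lam)
  then show "P (h \<cdot> \<iota> x) \<longleftrightarrow> P h" using T[of h "lam h x"] h by simp
qed

lemma L_induct [consumes 1, case_names one L]:
  assumes "g \<in> carrier G" "P \<one>\<^bsub>G\<^esub>"
    and L: "\<And>h x. h \<in> carrier G \<Longrightarrow> x \<in> X \<Longrightarrow> P (L x h) \<longleftrightarrow> P h"
  shows "P g"
  using assms(1,2)
proof (rule structure_group_induct)
  fix h x assume h: "h \<in> carrier G" "x \<in> X"
  have "h \<cdot> \<iota> x = L (rho h x) h" using h by (simp add: L_def rho_inv_rho)
  then show "P (h \<cdot> \<iota> x) \<longleftrightarrow> P h" using L[of h "rho h x"] h by simp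
qed

section \<open>The centralizer of the left translations\<close>

definition centralizes :: "('a gword set \<Rightarrow> 'a gword set) \<Rightarrow> bool" where
  "centralizes R \<longleftrightarrow> R \<in> carrier G \<rightarrow> carrier G \<and> (\<forall>x\<in>X. \<forall>h\<in>carrier G. R (L x h) = L x (R h))"

lemma centralizes_closed: "centralizes R \<Longrightarrow> h \<in> carrier G \<Longrightarrow> R h \<in> carrier G"
  by (auto simp: centralizes_def)

lemma centralizes_L:
  "centralizes R \<Longrightarrow> x \<in> X \<Longrightarrow> h \<in> carrier G \<Longrightarrow> R (L x h) = L x (R h)"
  by (auto simp: centralizes_def)

text \<open>The set where two centralizing maps agree is stable under every \<open>L x\<close> and
  its inverse, so it is all of \<open>G\<close> once it contains the identity.\<close>

lemma centralizes_unique: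
  assumes R: "centralizes R" "centralizes R'" and "R \<one>\<^bsub>G\<^esub> = R' \<one>\<^bsub>G\<^esub>" and "h \<in> carrier G"
  shows "R h = R' h"
  using assms(4,3)
proof (induction h rule: L_induct)
  case one
  then show ?case .
next
  case (L h x)
  then show ?case using R by (simp add: centralizes_L centralizes_closed L_inject)
qed

lemma centralizes_id: "centralizes (\<lambda>h. h)"
  by (simp add: centralizes_def)

lemma centralizes_comp: "centralizes R \<Longrightarrow> centralizes R' \<Longrightarrow> centralizes (\<lambda>h. R (R' h))"
  by (auto simp: centralizes_def Pi_iff)

lemma centralizes_T: "x \<in> X \<Longrightarrow> centralizes (T x)"
  by (auto simp: centralizes_def T_L_commute)

text \<open>Inverses are needed because the equivalence in \<open>T_induct\<close> also walks
  backwards along \<open>T x\<close>.\<close>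

lemma centralizes_T_inverse: assumes x: "x \<in> X"
  shows "\<exists>R. centralizes R \<and> (\<forall>h\<in>carrier G. T x (R h) = h \<and> R (T x h) = h)"
proof -
  define R where "R = inv_into (carrier G) (T x)"
  have R: "T x (R h) = h" "R (T x h) = h" "R h \<in> carrier G" if "h \<in> carrier G" for h
    using that bij_betw_inv_into_right[OF T_bij[OF x]] bij_betw_inv_into_left[OF T_bij[OF x]]
      bij_betwE[OF bij_betw_inv_into[OF T_bij[OF x]]]
    by (auto simp: R_def)
  have "R (L y h) = L y (R h)" if "y \<in> X" "h \<in> carrier G" for y h
  proof -
    have "T x (L y (R h)) = L y h" using T_L_commute x that R by simp
    then show ?thesis using R(2)[of "L y (R h)"] R(3) that by simp
  qed
  then have "centralizes R" using R by (auto simp: centralizes_def)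
  then show ?thesis using R by blast
qed

lemma centralizes_exists: "k \<in> carrier G \<Longrightarrow> \<exists>R. centralizes R \<and> R \<one>\<^bsub>G\<^esub> = k"
proof (induction k rule: T_induct)
  case one
  then show ?case using centralizes_id by blast
next
  case (T h x)
  obtain S where S: "centralizes S" "\<forall>h\<in>carrier G. T x (S h) = h \<and> S (T x h) = h"
    using centralizes_T_inverse T by blast
  show ?case
  proof
    assume "\<exists>R. centralizes R \<and> R \<one>\<^bsub>G\<^esub> = T x h"
    then obtain R where R: "centralizes R" "R \<one>\<^bsub>G\<^esub> = T x h" by blast
    have "S (R \<one>\<^bsub>G\<^esub>) = h" using S(2) R(2) T by auto
    then show "\<exists>R. centralizes R \<and> R \<one>\<^bsub>G\<^esub> = h" using centralizes_comp[OF S(1) R(1)] by blast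
  next
    assume "\<exists>R. centralizes R \<and> R \<one>\<^bsub>G\<^esub> = h"
    then show "\<exists>R. centralizes R \<and> R \<one>\<^bsub>G\<^esub> = T x h"
      using centralizes_comp[OF centralizes_T[OF T(2)]] by blast
  qed
qed

text \<open>Moving \<open>k\<close> back to the identity supplies the additive inverses.\<close>

lemma centralizes_exists_to_one: "k \<in> carrier G \<Longrightarrow> \<exists>R. centralizes R \<and> R k = \<one>\<^bsub>G\<^esub>"
proof (induction k rule: T_induct)
  case one
  then show ?case using centralizes_id by blast
next
  case (T h x)
  obtain S where S: "centralizes S" "\<forall>h\<in>carrier G. T x (S h) = h \<and> S (T x h) = h"
    using centralizes_T_inverse T by blast
  show ?case
  proof
    assume "\<exists>R. centralizes R \<and> R (T x h) = \<one>\<^bsub>G\<^esub>"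
    then show "\<exists>R. centralizes R \<and> R h = \<one>\<^bsub>G\<^esub>"
      using centralizes_comp[OF _ centralizes_T[OF T(2)]] by blast
  next
    assume "\<exists>R. centralizes R \<and> R h = \<one>\<^bsub>G\<^esub>"
    then obtain R where R: "centralizes R" "R h = \<one>\<^bsub>G\<^esub>" by blast
    have "R (S (T x h)) = \<one>\<^bsub>G\<^esub>" using S(2) R(2) T by auto
    then show "\<exists>R. centralizes R \<and> R (T x h) = \<one>\<^bsub>G\<^esub>"
      using centralizes_comp[OF R(1) S(1)] by blast
  qed
qed

section \<open>The additive group of the skew brace\<close>

definition translation :: "'a gword set \<Rightarrow> 'a gword set \<Rightarrow> 'a gword set" where
  "translation k = (SOME R. centralizes R \<and> R \<one>\<^bsub>G\<^esub> = k)"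

text \<open>\<open>translation k\<close> is meant as \<open>h \<mapsto> h \<oplus> k\<close>:
  addition is the composition of centralizing maps, transported along evaluation at the
  identity.\<close>

definition A :: "'a gword set monoid" where
  "A = \<lparr>carrier = carrier G, mult = (\<lambda>h k. translation k h), one = \<one>\<^bsub>G\<^esub>\<rparr>"

abbreviation aplus (infixl "\<oplus>" 65) where "a \<oplus> b \<equiv> a \<otimes>\<^bsub>A\<^esub> b"

lemma carrier_A [simp]: "carrier A = carrier G" and one_A [simp]: "\<one>\<^bsub>A\<^esub> = \<one>\<^bsub>G\<^esub>"
  and aplus_translation: "h \<oplus> k = translation k h"
  by (simp_all add: A_def)

lemma
  assumes "k \<in> carrier G"
  shows centralizes_translation: "centralizes (translation k)"
    and translation_one: "translation k \<one>\<^bsub>G\<^esub> = k"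
  using someI_ex[OF centralizes_exists[OF assms]] by (auto simp: translation_def)

text \<open>By \<open>centralizes_unique\<close> the choice made in \<open>translation\<close> is
  the only possible one on the carrier.\<close>

lemma translation_eq:
  "centralizes R \<Longrightarrow> R \<one>\<^bsub>G\<^esub> = k \<Longrightarrow> h \<in> carrier G \<Longrightarrow> translation k h = R h"
  by (metis centralizes_closed centralizes_translation centralizes_unique one_closed
      translation_one)

lemma aplus_closed: "h \<in> carrier G \<Longrightarrow> k \<in> carrier G \<Longrightarrow> h \<oplus> k \<in> carrier G"
  using centralizes_translation centralizes_closed by (simp add: aplus_translation)

lemma aplus_assoc:
  assumes "h \<in> carrier G" "k \<in> carrier G" "l \<in> carrier G"
  shows "h \<oplus> k \<oplus> l = h \<oplus> (k \<oplus> l)"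
proof -
  have "centralizes (\<lambda>h. translation l (translation k h))"
    using centralizes_comp centralizes_translation assms by blast
  then have "translation (translation l k) h = translation l (translation k h)"
    by (rule translation_eq) (use translation_one assms in auto)
  then show ?thesis by (simp add: aplus_translation)
qed

lemma one_aplus: "k \<in> carrier G \<Longrightarrow> \<one>\<^bsub>G\<^esub> \<oplus> k = k"
  by (simp add: aplus_translation translation_one)

lemma aplus_one: "k \<in> carrier G \<Longrightarrow> k \<oplus> \<one>\<^bsub>G\<^esub> = k"
  using translation_eq[OF centralizes_id] by (simp add: aplus_translation)

lemma aplus_right_inverse:
  assumes k: "k \<in> carrier G" shows "\<exists>h\<in>carrier G. k \<oplus> h = \<one>\<^bsub>G\<^esub>"
proof -
  obtain R where R: "centralizes R" "R k = \<one>\<^bsub>G\<^esub>" using centralizes_exists_to_one k by blast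
  have "k \<oplus> R \<one>\<^bsub>G\<^esub> = \<one>\<^bsub>G\<^esub>"
    using translation_eq[OF R(1) _ k] R(2) by (simp add: aplus_translation)
  then show ?thesis using centralizes_closed[OF R(1)] by blast
qed

sublocale add: group A
proof (rule groupI)
  fix k assume "k \<in> carrier A"
  then have k: "k \<in> carrier G" by simp
  obtain h where h: "h \<in> carrier G" "k \<oplus> h = \<one>\<^bsub>G\<^esub>" using aplus_right_inverse k by blast
  \<comment> \<open>\<open>groupI\<close> asks for a left inverse; the right inverse
    \<open>l\<close> of \<open>h\<close> turns out to be \<open>k\<close>.\<close>
  obtain l where l: "l \<in> carrier G" "h \<oplus> l = \<one>\<^bsub>G\<^esub>" using aplus_right_inverse h by blast
  have "k = k \<oplus> (h \<oplus> l)" using l k aplus_one by simp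
  also have "\<dots> = l" using aplus_assoc[OF k h(1) l(1)] h l one_aplus by simp
  finally have "h \<oplus> k = \<one>\<^bsub>A\<^esub>" using l by simp
  then show "\<exists>h\<in>carrier A. h \<oplus> k = \<one>\<^bsub>A\<^esub>" using h by auto
qed (use aplus_closed aplus_assoc one_aplus in auto)

lemma aplus_iota: "x \<in> X \<Longrightarrow> h \<in> carrier G \<Longrightarrow> h \<oplus> \<iota> x = T x h"
  unfolding aplus_translation
  by (rule translation_eq[OF centralizes_T]) (auto simp: T_def lam_one)

text \<open>\<open>translation h\<close> commutes with \<open>L x\<close>; this is evaluated at the
  identity.\<close>

lemma iota_aplus:
  assumes "x \<in> X" "h \<in> carrier G" shows "\<iota> x \<oplus> h = L x h"
proof -
  have "L x \<one>\<^bsub>G\<^esub> = \<iota> x" using assms by (simp add: L_def rho_one)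
  then show ?thesis
    using assms centralizes_L[OF centralizes_translation, of h x "\<one>\<^bsub>G\<^esub>"]
    by (simp add: aplus_translation translation_one)
qed

text \<open>Both sums equal \<open>\<iota> y \<cdot> \<iota> (\<psi> y x)\<close>. These are the
  defining relations of \<open>A(X,r)\<close>, with \<open>y\<close> written for
  \<open>\<sigma> x z\<close>.\<close>

lemma iota_aplus_iota: "x \<in> X \<Longrightarrow> y \<in> X \<Longrightarrow> \<iota> x \<oplus> \<iota> y = \<iota> y \<oplus> \<iota> (\<sigma> y (\<psi> y x))"
  using lam_inv_lam[of "\<iota> y" "\<psi> y x"]
  by (subst iota_aplus, simp, simp, subst aplus_iota) (auto simp: L_def T_def rho_inv_iota lam_iota)

section \<open>The brace identity and the lambda maps\<close>

lemma mult_T: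
  assumes "a \<in> carrier G" "h \<in> carrier G" "x \<in> X"
  shows "a \<cdot> T x h = T (lam a x) (a \<cdot> h)"
proof -
  have "lam (inv\<^bsub>G\<^esub> (a \<cdot> h)) (lam a x) = lam (inv\<^bsub>G\<^esub> h) x"
    using assms by (simp add: inv_mult_group lam.composition_rule lam_inv_lam)
  then show ?thesis using assms by (simp add: T_def m_assoc)
qed

lemma aplus_T:
  assumes "b \<in> carrier G" "c \<in> carrier G" "x \<in> X"
  shows "b \<oplus> T x c = T x (b \<oplus> c)"
  using assms aplus_assoc[of b c "\<iota> x"] by (simp add: aplus_iota aplus_closed)

lemma add_inv_closed [simp]: "a \<in> carrier G \<Longrightarrow> inv\<^bsub>A\<^esub> a \<in> carrier G"
  using add.inv_closed[of a] by simp

text \<open>Induction on \<open>c\<close>: replacing \<open>c\<close> by \<open>T x c\<close>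
  applies the same bijection \<open>T (lam a x)\<close> to both sides, by \<open>mult_T\<close> and
  \<open>aplus_T\<close>.\<close>

lemma brace_identity:
  assumes "a \<in> carrier G" "b \<in> carrier G" "c \<in> carrier G"
  shows "a \<cdot> (b \<oplus> c) = a \<cdot> b \<oplus> inv\<^bsub>A\<^esub> a \<oplus> a \<cdot> c"
  using assms(3)
proof (induction c rule: T_induct)
  case one
  then show ?case
    using assms add.l_inv[of a] by (simp add: aplus_assoc aplus_one)
next
  case (T c x)
  then show ?case
    using assms by (simp add: aplus_T mult_T T_inject aplus_closed)
qed

lemma skew_left_brace_A: "skew_left_brace A G"
proof
  show "carrier A = carrier G" by simp
qed (rule brace_identity)

definition lambda :: "'a gword set \<Rightarrow> 'a gword set \<Rightarrow> 'a gword set" where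
  "lambda a b = inv\<^bsub>A\<^esub> a \<oplus> a \<cdot> b"

lemma lambda_closed [simp]: "a \<in> carrier G \<Longrightarrow> b \<in> carrier G \<Longrightarrow> lambda a b \<in> carrier G"
  by (simp add: lambda_def aplus_closed)

lemma mult_eq_aplus_lambda:
  assumes "a \<in> carrier G" "b \<in> carrier G"
  shows "a \<cdot> b = a \<oplus> lambda a b"
  using assms add.r_inv[of a] by (simp add: lambda_def aplus_assoc[symmetric] one_aplus)

lemma lambda_iota:
  assumes "a \<in> carrier G" "x \<in> X"
  shows "lambda a (\<iota> x) = \<iota> (lam a x)"
proof -
  have "a \<cdot> \<iota> x = a \<oplus> \<iota> (lam a x)"
    using assms by (simp add: aplus_iota T_def lam_inv_lam)
  then show ?thesis
    using assms add.l_inv[of a] by (simp add: lambda_def aplus_assoc[symmetric] one_aplus)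
qed

lemma is_structure_brace_add_A: "is_structure_brace_add X r A"
proof -
  have "brace_solution A G (\<iota> x, \<iota> y) = map_prod \<iota> \<iota> (r (x, y))" if "x \<in> X" "y \<in> X" for x y
  proof -
    have "brace_lambda A G (\<iota> x) (\<iota> y) = \<iota> (\<sigma> x y)"
      using lambda_iota[of "\<iota> x" y] that by (simp add: brace_lambda_def lambda_def lam_iota)
    moreover have "inv\<^bsub>G\<^esub> (\<iota> (\<sigma> x y)) \<cdot> \<iota> x \<cdot> \<iota> y = \<iota> (\<tau> y x)"
      using that iota_braid[of x y] by (simp add: m_assoc) (simp add: m_assoc[symmetric])
    ultimately show ?thesis by (simp add: brace_solution_def r_eq)
  qed
  then show ?thesis
    using skew_left_brace_A by (simp add: is_structure_brace_add_def G_def \<iota>_def)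
qed

text \<open>\<open>structure_brace_add\<close> may be a record different from \<open>A\<close>;
  existence of \<open>A\<close> guarantees that the chosen one has the property of a structure
  brace, which fixes its values on generators.\<close>

lemma inj_map_iota:
  assumes "x \<in> X" "y \<in> X"
  shows "inj_map X r (\<iota> x, \<iota> y) = (\<iota> (\<sigma> x y), \<iota> (\<tau> y x))"
proof -
  have "is_structure_brace_add X r (structure_brace_add X r)"
    unfolding structure_brace_add_def using is_structure_brace_add_A by (rule someI)
  then show ?thesis
    using assms by (simp add: is_structure_brace_add_def inj_map_def inj_carrier_def \<iota>_def r_eq)
qed

end

section \<open>The transfer to a central subgroup\<close>

text \<open>The transfer multiplies, over all cosets \<open>C\<close>, the factors
  \<open>w C g\<close> by which the representative of \<open>C\<close> times \<open>g\<close>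
  deviates from the representative of \<open>C #> g\<close>. For \<open>k\<close> in
  \<open>K\<close> every coset is fixed and every factor is \<open>k\<close>.\<close>

lemma (in group) central_transfer:
  assumes K: "subgroup K G"
    and central: "\<And>k g. k \<in> K \<Longrightarrow> g \<in> carrier G \<Longrightarrow> k \<otimes> g = g \<otimes> k"
    and fin: "finite (rcosets K)"
  shows "\<exists>V \<in> hom G (G\<lparr>carrier := K\<rparr>). \<forall>k\<in>K. V k = k [^] card (rcosets K)"
proof -
  interpret K: subgroup K G by fact
  let ?Z = "G\<lparr>carrier := K\<rparr>"
  have "group ?Z" by (rule K.subgroup_is_group[OF is_group])
  \<comment> \<open>Centrality makes \<open>K\<close> abelian, which gives sense to a product over
    an unordered set of cosets.\<close>
  then interpret Z: comm_group ?Z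
    by (rule group.group_comm_groupI) (use central in auto)
  define t where "t C = (SOME c. c \<in> C)" for C :: "'a set"
  have t: "t C \<in> carrier G" "C = K #> t C" if C: "C \<in> rcosets K" for C
  proof -
    obtain c where c: "c \<in> carrier G" "C = K #> c" using C by (auto simp: RCOSETS_def)
    then have "t C \<in> C" unfolding t_def using rcos_self[OF c(1) K] by (intro someI) auto
    then show "C = K #> t C" using repr_independence[of "t C" K c] c K by simp
    show "t C \<in> carrier G" using \<open>t C \<in> C\<close> C K.rcosets_carrier[OF is_group] by blast
  qed
  have coset: "C #> g \<in> rcosets K" if "C \<in> rcosets K" "g \<in> carrier G" for C g
    using t[OF that(1)] that rcosetsI[of K "t C \<otimes> g"] coset_mult_assoc[of K "t C" g]
      K.subset by auto
  define w where "w C g = t C \<otimes> g \<otimes> inv (t (C #> g))" for C g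
  have w: "w C g \<in> K" if C: "C \<in> rcosets K" "g \<in> carrier G" for C g
  proof -
    have "K #> (t C \<otimes> g) = K #> t (C #> g)"
      using t[OF C(1)] t[OF coset[OF C]] C coset_mult_assoc[of K "t C" g] K.subset by metis
    then have "t C \<otimes> g \<in> K #> t (C #> g)"
      using rcos_self[OF _ K, of "t C \<otimes> g"] t C by auto
    then show ?thesis
      using K.rcos_module[OF is_group, of "t (C #> g)" "t C \<otimes> g"] t coset C by (simp add: w_def)
  qed
  define V where "V g = finprod ?Z (\<lambda>C. w C g) (rcosets K)" for g
  have "V \<in> hom G ?Z"
  proof (rule homI)
    fix g assume g: "g \<in> carrier G"
    show "V g \<in> carrier ?Z" unfolding V_def by (rule Z.finprod_closed) (use w g in auto)
  next
    fix g h assume g: "g \<in> carrier G" "h \<in> carrier G"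
    have sub: "C \<subseteq> carrier G" if "C \<in> rcosets K" for C
      using that K.rcosets_carrier[OF is_group] by blast
    have cancel: "C #> g #> inv g = C" "C #> inv g #> g = C" if "C \<in> rcosets K" for C
      using sub[OF that] g by (simp_all add: coset_mult_assoc)
    have inj: "inj_on (\<lambda>C. C #> g) (rcosets K)"
      using cancel by (metis inj_on_inverseI)
    have img: "(\<lambda>C. C #> g) ` (rcosets K) = rcosets K"
      using coset g cancel(2) by (auto simp: image_iff) (metis inv_closed)
    \<comment> \<open>Cocycle identity; with the reindexing \<open>C \<mapsto> C #> g\<close> it
      makes \<open>V\<close> multiplicative.\<close>
    have "w C (g \<otimes> h) = w C g \<otimes> w (C #> g) h" if C: "C \<in> rcosets K" for C
    proof -
      have "C #> (g \<otimes> h) = C #> g #> h" using sub[OF C] g by (simp add: coset_mult_assoc)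
      moreover have "t C \<in> carrier G" "t (C #> g) \<in> carrier G" "t (C #> g #> h) \<in> carrier G"
        using t coset C g by auto
      ultimately show ?thesis
        using g by (simp add: w_def m_assoc inv_solve_left)
    qed
    then have "V (g \<otimes> h) = finprod ?Z (\<lambda>C. w C g \<otimes>\<^bsub>?Z\<^esub> w (C #> g) h) (rcosets K)"
      unfolding V_def by (intro Z.finprod_cong) (use w coset g in \<open>auto simp: simp_implies_def\<close>)
    also have "\<dots> = V g \<otimes>\<^bsub>?Z\<^esub> finprod ?Z (\<lambda>C. w (C #> g) h) (rcosets K)"
      unfolding V_def by (rule Z.finprod_multf) (use w coset g in auto)
    also have "finprod ?Z (\<lambda>C. w (C #> g) h) (rcosets K)
        = finprod ?Z (\<lambda>C. w C h) ((\<lambda>C. C #> g) ` (rcosets K))"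
      by (rule Z.finprod_reindex[symmetric]) (use w coset g inj in \<open>auto simp: img\<close>)
    finally show "V (g \<otimes> h) = V g \<otimes>\<^bsub>?Z\<^esub> V h" by (simp add: V_def img)
  qed
  moreover have "V k = k [^] card (rcosets K)" if k: "k \<in> K" for k
  proof -
    have kG: "k \<in> carrier G" using k K.subset by auto
    have "w C k = k" if C: "C \<in> rcosets K" for C
    proof -
      have "C #> k = K #> (t C \<otimes> k)"
        using t[OF C] kG K.subset coset_mult_assoc[of K "t C" k] by metis
      also have "\<dots> = K #> k #> t C"
        using t[OF C] kG K.subset central[OF k, of "t C"] coset_mult_assoc[of K k "t C"] by simp
      also have "\<dots> = C" using t[OF C] K.rcos_const[OF is_group k] by simp
      finally have "C #> k = C" .
      then show ?thesis
        using t[OF C] kG central[OF k, of "t C", symmetric] by (simp add: w_def m_assoc)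
    qed
    then have "V k = finprod ?Z (\<lambda>C. k) (rcosets K)"
      unfolding V_def by (intro Z.finprod_cong) (use k in \<open>auto simp: simp_implies_def\<close>)
    also have "\<dots> = k [^]\<^bsub>?Z\<^esub> card (rcosets K)" by (rule Z.finprod_const) (use k in simp)
    finally show ?thesis by (simp only: nat_pow_consistent[symmetric])
  qed
  ultimately show ?thesis by blast
qed

text \<open>Pigeonhole: among the cosets of the powers of \<open>g\<close> two coincide, and the
  quotient of the two powers lies in \<open>K\<close>.\<close>

lemma (in group) finite_index_power:
  assumes K: "subgroup K G" and fin: "finite (rcosets K)" and g: "g \<in> carrier G"
  shows "\<exists>n::nat. n > 0 \<and> g [^] n \<in> K"
proof -
  interpret K: subgroup K G by fact
  have "range (\<lambda>i::nat. K #> g [^] i) \<subseteq> rcosets K"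
    using g K.subset by (auto intro: rcosetsI)
  then have "finite (range (\<lambda>i::nat. K #> g [^] i))" using fin finite_subset by blast
  then have "\<not> inj (\<lambda>i::nat. K #> g [^] i)" using finite_imageD by blast
  then obtain i j :: nat where ij: "i < j" "K #> g [^] i = K #> g [^] j"
    unfolding inj_def by (metis linorder_neqE_nat)
  have "g [^] j \<in> K #> g [^] i" using rcos_self[OF _ K, of "g [^] j"] g ij by simp
  then have "g [^] j \<otimes> inv (g [^] i) \<in> K"
    using K.rcos_module[OF is_group, of "g [^] i" "g [^] j"] g by simp
  moreover have "g [^] j = g [^] (j - i) \<otimes> g [^] i" using g ij(1) by (simp add: nat_pow_mult)
  ultimately have "g [^] (j - i) \<in> K" using g by (simp add: m_assoc)
  then show ?thesis using ij(1) by (intro exI[of _ "j - i"]) simp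
qed

section \<open>Torsion-free structure groups\<close>

context finite_nondegenerate_solution
begin

text \<open>If \<open>\<sigma> x z = y\<close>, then \<open>r (x, z) = (y, \<psi> y x)\<close>, and
  \<open>\<sigma> y (\<psi> y x)\<close> is the first coordinate of \<open>r (r (x, z))\<close>. So
  the condition is involutivity in the first coordinate; the defining relations yield the second by
  cancellation.\<close>

lemma involutive_injectivization_iff:
  "involutive_solution (inj_carrier X r) (inj_map X r) \<longleftrightarrow>
    (\<forall>x\<in>X. \<forall>y\<in>X. \<iota> (\<sigma> y (\<psi> y x)) = \<iota> x)"
proof
  assume "involutive_solution (inj_carrier X r) (inj_map X r)"
  then interpret I: involutive_solution "inj_carrier X r" "inj_map X r" .
  show "\<forall>x\<in>X. \<forall>y\<in>X. \<iota> (\<sigma> y (\<psi> y x)) = \<iota> x"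
  proof (intro ballI)
    fix x y assume xy: "x \<in> X" "y \<in> X"
    obtain z where z: "z \<in> X" "\<sigma> x z = y" using sigma_surj[of x y] xy by blast
    have "inj_map X r (inj_map X r (\<iota> x, \<iota> z)) = (\<iota> x, \<iota> z)"
      by (rule I.involutive) (use xy z in \<open>auto simp: inj_carrier_def \<iota>_def\<close>)
    then show "\<iota> (\<sigma> y (\<psi> y x)) = \<iota> x"
      using xy z psi_sigma[of x z] by (simp add: inj_map_iota)
  qed
next
  assume crit: "\<forall>x\<in>X. \<forall>y\<in>X. \<iota> (\<sigma> y (\<psi> y x)) = \<iota> x"
  have carrier: "inj_carrier X r = \<iota> ` X" by (simp add: inj_carrier_def \<iota>_def)
  show "involutive_solution (inj_carrier X r) (inj_map X r)"
    unfolding carrier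
  proof
    show "\<iota> ` X \<noteq> {}" using nonempty by simp
  next
    have map: "inj_map X r (map_prod \<iota> \<iota> p) = map_prod \<iota> \<iota> (r p)" if "p \<in> X \<times> X" for p
      using that by (auto simp: inj_map_iota r_eq)
    have sq: "(\<iota> ` X) \<times> (\<iota> ` X) = map_prod \<iota> \<iota> ` (X \<times> X)" by (simp add: map_prod_surj_on)
    \<comment> \<open>Surjectivity is inherited from \<open>r\<close>; injectivity then follows from
      finiteness.\<close>
    have "inj_map X r ` (\<iota> ` X \<times> \<iota> ` X) = map_prod \<iota> \<iota> ` (r ` (X \<times> X))"
      unfolding sq image_image by (rule image_cong) (simp_all add: map)
    then have img: "inj_map X r ` (\<iota> ` X \<times> \<iota> ` X) = \<iota> ` X \<times> \<iota> ` X"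
      using bijective by (simp add: bij_betw_def sq)
    then show "bij_betw (inj_map X r) (\<iota> ` X \<times> \<iota> ` X) (\<iota> ` X \<times> \<iota> ` X)"
      using finite_X by (simp add: bij_betw_def eq_card_imp_inj_on)
  next
    fix p assume "p \<in> \<iota> ` X \<times> \<iota> ` X \<times> \<iota> ` X"
    then obtain x y z where p: "p = (\<iota> x, \<iota> y, \<iota> z)" "x \<in> X" "y \<in> X" "z \<in> X" by auto
    have "ybe_r1 r (ybe_r2 r (ybe_r1 r (x, y, z))) = ybe_r2 r (ybe_r1 r (ybe_r2 r (x, y, z)))"
      by (rule braid) (use p in auto)
    then show "ybe_r1 (inj_map X r) (ybe_r2 (inj_map X r) (ybe_r1 (inj_map X r) p)) =
        ybe_r2 (inj_map X r) (ybe_r1 (inj_map X r) (ybe_r2 (inj_map X r) p))"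
      using p by (simp add: ybe_r1_def ybe_r2_def inj_map_iota r_eq)
  next
    fix p assume "p \<in> \<iota> ` X \<times> \<iota> ` X"
    then obtain x y where p: "p = (\<iota> x, \<iota> y)" "x \<in> X" "y \<in> X" by auto
    define u v where "u = \<sigma> x y" and "v = \<tau> y x"
    have uv: "u \<in> X" "v \<in> X" using p by (auto simp: u_def v_def)
    have 1: "\<iota> (\<sigma> u v) = \<iota> x"
      using crit[rule_format, of x u] p uv psi_sigma[of x y] by (simp add: u_def v_def)
    have "\<iota> x \<cdot> \<iota> (\<tau> v u) = \<iota> x \<cdot> \<iota> y"
      using iota_braid[of u v] iota_braid[of x y] p uv 1 by (simp add: u_def v_def)
    then have "\<iota> (\<tau> v u) = \<iota> y" using p uv by simp
    then show "inj_map X r (inj_map X r p) = p"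
      using p uv 1 by (simp add: inj_map_iota u_def[symmetric] v_def[symmetric])
  qed
qed

section \<open>The common kernel of the two actions\<close>

definition K :: "'a gword set set" where
  "K = {k \<in> carrier G. \<forall>x\<in>X. lam k x = x \<and> rho k x = x}"

lemma K_closed: "k \<in> K \<Longrightarrow> k \<in> carrier G"
  by (simp add: K_def)

lemma subgroup_K: "subgroup K G"
proof
  show "K \<subseteq> carrier G" by (auto simp: K_def)
  show "\<one>\<^bsub>G\<^esub> \<in> K" by (simp add: K_def lam_one rho_one)
next
  fix k l assume "k \<in> K" "l \<in> K"
  then show "k \<cdot> l \<in> K" by (simp add: K_def lam.composition_rule rho.composition_rule)
next
  fix k assume "k \<in> K"
  then show "inv\<^bsub>G\<^esub> k \<in> K"
    using lam_inv_lam[of k] rho_inv_rho[of k] by (fastforce simp: K_def)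
qed

text \<open>As \<open>lam k\<close> is trivial on \<open>X\<close>, left multiplication by
  \<open>k\<close> commutes with every \<open>T x\<close>. So does addition of \<open>k\<close> on
  the left, and both send the identity to \<open>k\<close>.\<close>

lemma K_aplus:
  assumes k: "k \<in> K" and g: "g \<in> carrier G"
  shows "k \<oplus> g = k \<cdot> g"
  using g
proof (induction g rule: T_induct)
  case one
  then show ?case using K_closed[OF k] by (simp add: aplus_one)
next
  case (T g x)
  have "k \<cdot> T x g = T x (k \<cdot> g)" using mult_T[of k g x] T k by (simp add: K_def)
  then show ?case using T K_closed[OF k] by (simp add: aplus_T T_inject aplus_closed)
qed

text \<open>Triviality of \<open>rho k\<close> gives
  \<open>\<iota> x \<oplus> k = k \<cdot> \<iota> x\<close>, which is
  \<open>k \<oplus> \<iota> x\<close> by \<open>K_aplus\<close>; induction passes from generators to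
  all of \<open>G\<close>.\<close>

lemma K_central:
  assumes k: "k \<in> K" and g: "g \<in> carrier G"
  shows "k \<oplus> g = g \<oplus> k"
  using g
proof (induction g rule: T_induct)
  case one
  then show ?case using K_closed[OF k] by (simp add: aplus_one one_aplus)
next
  case (T g x)
  have kG: "k \<in> carrier G" using K_closed k by simp
  have "rho (inv\<^bsub>G\<^esub> k) x = x" using rho_inv_rho[OF kG T(2)] k T(2) by (simp add: K_def)
  then have "\<iota> x \<oplus> k = k \<cdot> \<iota> x" using iota_aplus T(2) kG by (simp add: L_def)
  also have "\<dots> = k \<oplus> \<iota> x" using K_aplus[OF k] T(2) by simp
  finally have "T x g \<oplus> k = g \<oplus> (k \<oplus> \<iota> x)"
    using T kG by (simp add: aplus_iota[symmetric] aplus_assoc)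
  also have "\<dots> = T x (g \<oplus> k)" using T kG by (simp add: aplus_iota aplus_T)
  finally show ?case using T kG by (simp add: aplus_T T_inject aplus_closed)
qed

lemma inv_A_K: assumes k: "k \<in> K" shows "inv\<^bsub>A\<^esub> k = inv\<^bsub>G\<^esub> k"
proof (rule add.inv_equality)
  have "inv\<^bsub>G\<^esub> k \<in> K" using subgroup_K k by (rule subgroup.m_inv_closed)
  then show "inv\<^bsub>G\<^esub> k \<oplus> k = \<one>\<^bsub>A\<^esub>" using K_aplus K_closed k by simp
qed (use K_closed k in auto)

lemma subgroup_K_A: "subgroup K A"
proof -
  interpret K: subgroup K G by (rule subgroup_K)
  show ?thesis
    by unfold_locales (use K_closed in \<open>auto simp: K_aplus inv_A_K\<close>)
qed

lemma rcosets_K_A: "rcosets\<^bsub>A\<^esub> K = rcosets\<^bsub>G\<^esub> K"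
  by (auto simp: RCOSETS_def r_coset_def K_aplus)

text \<open>A coset is determined by the pair of permutations of \<open>X\<close> that its elements
  induce, and there are finitely many such pairs.\<close>

lemma finite_rcosets_K: "finite (rcosets\<^bsub>G\<^esub> K)"
proof -
  define \<theta> where "\<theta> g = (restrict (lam g) X, restrict (rho g) X)" for g
  have "\<theta> ` carrier G \<subseteq> (X \<rightarrow>\<^sub>E X) \<times> (X \<rightarrow>\<^sub>E X)"
    by (auto simp: \<theta>_def)
  then have fin: "finite (\<theta> ` carrier G)"
    by (rule finite_subset) (simp add: finite_PiE finite_X)
  have coset: "K #>\<^bsub>G\<^esub> g = K #>\<^bsub>G\<^esub> h"
    if gh: "g \<in> carrier G" "h \<in> carrier G" "\<theta> g = \<theta> h" for g h
  proof -
    have res: "restrict (lam g) X = restrict (lam h) X" "restrict (rho g) X = restrict (rho h) X"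
      using gh(3) by (simp_all add: \<theta>_def)
    have eq: "lam g x = lam h x" "rho g x = rho h x" if "x \<in> X" for x
      using fun_cong[OF res(1), of x] fun_cong[OF res(2), of x] that by simp_all
    have "lam (g \<cdot> inv\<^bsub>G\<^esub> h) x = x \<and> rho (g \<cdot> inv\<^bsub>G\<^esub> h) x = x" if x: "x \<in> X" for x
    proof -
      have "lam (g \<cdot> inv\<^bsub>G\<^esub> h) x = lam h (lam (inv\<^bsub>G\<^esub> h) x)"
        using lam.composition_rule[of x g "inv\<^bsub>G\<^esub> h"] eq(1)[of "lam (inv\<^bsub>G\<^esub> h) x"] gh x by simp
      moreover have "rho (g \<cdot> inv\<^bsub>G\<^esub> h) x = rho h (rho (inv\<^bsub>G\<^esub> h) x)"
        using rho.composition_rule[of x g "inv\<^bsub>G\<^esub> h"] eq(2)[of "rho (inv\<^bsub>G\<^esub> h) x"] gh x by simp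
      ultimately show ?thesis
        using lam_lam_inv[of h x] rho_inv_rho[of "inv\<^bsub>G\<^esub> h" x] gh x by simp
    qed
    then have "g \<cdot> inv\<^bsub>G\<^esub> h \<in> K" using gh by (simp add: K_def)
    then have "g \<in> K #>\<^bsub>G\<^esub> h"
      using subgroup.rcos_module[OF subgroup_K is_group] gh by blast
    then show ?thesis using repr_independence[OF _ _ subgroup_K, of g h] gh by simp
  qed
  \<comment> \<open>A section of \<open>\<theta>\<close>, which exhibits the cosets as images of the
    finitely many values of \<open>\<theta>\<close>.\<close>
  define s where "s q = (SOME g. g \<in> carrier G \<and> \<theta> g = q)" for q
  have "rcosets\<^bsub>G\<^esub> K \<subseteq> (\<lambda>q. K #>\<^bsub>G\<^esub> s q) ` (\<theta> ` carrier G)"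
  proof
    fix C assume "C \<in> rcosets\<^bsub>G\<^esub> K"
    then obtain g where g: "g \<in> carrier G" "C = K #>\<^bsub>G\<^esub> g" by (auto simp: RCOSETS_def)
    have "s (\<theta> g) \<in> carrier G \<and> \<theta> (s (\<theta> g)) = \<theta> g"
      unfolding s_def by (rule someI[of _ g]) (use g in simp)
    then have "C = K #>\<^bsub>G\<^esub> s (\<theta> g)" using coset[of g "s (\<theta> g)"] g by simp
    then show "C \<in> (\<lambda>q. K #>\<^bsub>G\<^esub> s q) ` (\<theta> ` carrier G)" using g by blast
  qed
  then show ?thesis using fin finite_surj by blast
qed

lemma lambda_hom:
  assumes "a \<in> carrier G" "b \<in> carrier G" "c \<in> carrier G"
  shows "lambda a (b \<oplus> c) = lambda a b \<oplus> lambda a c"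
  using assms by (simp add: lambda_def brace_identity aplus_assoc aplus_closed)

text \<open>Powers append factors on the right, while \<open>K_aplus\<close> treats a factor
  \<open>k\<close> on the left; centrality of \<open>k\<close> bridges the two.\<close>

lemma pow_A_K:
  assumes k: "k \<in> K" shows "k [^]\<^bsub>A\<^esub> (n::nat) = k [^]\<^bsub>G\<^esub> n"
proof (induction n)
  case (Suc n)
  have "k [^]\<^bsub>G\<^esub> n \<oplus> k = k \<oplus> k [^]\<^bsub>G\<^esub> n" using K_central[OF k] K_closed[OF k] by simp
  also have "\<dots> = k \<cdot> k [^]\<^bsub>G\<^esub> n" using K_aplus[OF k] K_closed[OF k] by simp
  also have "\<dots> = k [^]\<^bsub>G\<^esub> Suc n" using K_closed[OF k] nat_pow_Suc2 by simp
  finally show ?case using Suc by simp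
qed simp

text \<open>The elements killed by all homomorphisms from the additive group to \<open>K\<close> are closed under
  both operations, since \<open>\<lambda>\<^sub>a\<close> is an additive endomorphism. The transfer shows that they are
  torsion elements.\<close>

definition D :: "'a gword set set" where
  "D = {d \<in> carrier G. \<forall>f \<in> hom A (A\<lparr>carrier := K\<rparr>). f d = \<one>\<^bsub>G\<^esub>}"

lemma D_mult:
  assumes d: "d \<in> D" "e \<in> D" shows "d \<cdot> e \<in> D"
proof -
  have G: "d \<in> carrier G" "e \<in> carrier G" using d by (auto simp: D_def)
  have "f (d \<cdot> e) = \<one>\<^bsub>G\<^esub>" if f: "f \<in> hom A (A\<lparr>carrier := K\<rparr>)" for f
  proof -
    \<comment> \<open>Composing \<open>f\<close> with the additive endomorphism
      \<open>lambda d\<close> gives another homomorphism to \<open>K\<close>.\<close>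
    have "(\<lambda>b. f (lambda d b)) \<in> hom A (A\<lparr>carrier := K\<rparr>)"
      using f G by (auto simp: hom_def Pi_iff lambda_hom)
    then have "f (lambda d e) = \<one>\<^bsub>G\<^esub>" using d by (auto simp: D_def)
    moreover have "f d = \<one>\<^bsub>G\<^esub>" using d f by (auto simp: D_def)
    moreover have "f (d \<oplus> lambda d e) = f d \<oplus> f (lambda d e)"
      using hom_mult[OF f, of d "lambda d e"] G by simp
    ultimately show ?thesis using mult_eq_aplus_lambda[OF G] one_aplus by simp
  qed
  then show ?thesis using G by (simp add: D_def)
qed

lemma D_pow: "d \<in> D \<Longrightarrow> n > 0 \<Longrightarrow> d [^]\<^bsub>G\<^esub> (n::nat) \<in> D"
proof (induction n)
  case (Suc n)
  then show ?case by (cases n) (auto simp: D_mult, auto simp: D_def)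
qed simp

lemma D_torsion:
  assumes d: "d \<in> D" shows "\<exists>n::nat. n > 0 \<and> d [^]\<^bsub>G\<^esub> n = \<one>\<^bsub>G\<^esub>"
proof -
  have dG: "d \<in> carrier G" using d by (simp add: D_def)
  obtain n :: nat where n: "n > 0" "d [^]\<^bsub>G\<^esub> n \<in> K"
    using finite_index_power[OF subgroup_K finite_rcosets_K dG] by blast
  define k where "k = d [^]\<^bsub>G\<^esub> n"
  define m where "m = card (rcosets\<^bsub>G\<^esub> K)"
  have "K \<in> rcosets\<^bsub>G\<^esub> K" using subgroup.subgroup_in_rcosets[OF subgroup_K is_group] .
  then have m: "m > 0" using finite_rcosets_K by (auto simp: m_def card_gt_0_iff)
  \<comment> \<open>On \<open>K\<close> the transfer is the power with exponent the index
    \<open>m\<close>, and it kills \<open>k\<close> because \<open>k \<in> D\<close>.\<close>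
  obtain V where V: "V \<in> hom A (A\<lparr>carrier := K\<rparr>)" "\<forall>k\<in>K. V k = k [^]\<^bsub>A\<^esub> m"
    using add.central_transfer[OF subgroup_K_A] K_central finite_rcosets_K
    unfolding rcosets_K_A m_def by auto
  have "k \<in> D" using D_pow[OF d n(1)] by (simp add: k_def)
  then have "V k = \<one>\<^bsub>G\<^esub>" using V(1) by (auto simp: D_def)
  then have "k [^]\<^bsub>G\<^esub> m = \<one>\<^bsub>G\<^esub>" using V(2) n(2) pow_A_K[of k m] by (simp add: k_def)
  then have "d [^]\<^bsub>G\<^esub> (n * m) = \<one>\<^bsub>G\<^esub>" using dG by (simp add: k_def nat_pow_pow)
  then show ?thesis using n m by (intro exI[of _ "n * m"]) simp
qed

text \<open>Under a homomorphism \<open>f\<close> to the commutative group \<open>K\<close>, the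
  summand \<open>f (\<iota> y)\<close> cancels from the image of \<open>iota_aplus_iota\<close>,
  which leaves equal values at \<open>\<iota> x\<close> and its partner.\<close>

lemma difference_in_D:
  assumes "x \<in> X" "y \<in> X"
  shows "\<iota> x \<oplus> inv\<^bsub>A\<^esub> (\<iota> (\<sigma> y (\<psi> y x))) \<in> D"
proof -
  define x' where "x' = \<sigma> y (\<psi> y x)"
  have x': "x' \<in> X" using assms by (simp add: x'_def)
  have "f (\<iota> x \<oplus> inv\<^bsub>A\<^esub> (\<iota> x')) = \<one>\<^bsub>G\<^esub>" if f: "f \<in> hom A (A\<lparr>carrier := K\<rparr>)" for f
  proof -
    have fK: "f g \<in> K" if "g \<in> carrier G" for g using f that by (auto simp: hom_def)
    have f_mult: "f (g \<oplus> h) = f g \<oplus> f h" if "g \<in> carrier G" "h \<in> carrier G" for g h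
      using hom_mult[OF f, of g h] that by simp
    have fG: "f g \<in> carrier G" if "g \<in> carrier G" for g using fK K_closed that by blast
    have "f (\<iota> y) \<oplus> f (\<iota> x) = f (\<iota> x) \<oplus> f (\<iota> y)"
      using K_central fK fG assms by simp
    also have "\<dots> = f (\<iota> y) \<oplus> f (\<iota> x')"
      using f_mult[of "\<iota> x" "\<iota> y"] f_mult[of "\<iota> y" "\<iota> x'"] iota_aplus_iota[of x y] assms x'
      by (simp add: x'_def)
    finally have "f (\<iota> x) = f (\<iota> x')"
      using add.Units_l_cancel[of "f (\<iota> y)" "f (\<iota> x)" "f (\<iota> x')"] fG assms x' by (simp add: add.Units_eq)
    moreover have "f (\<iota> x' \<oplus> inv\<^bsub>A\<^esub> (\<iota> x')) = \<one>\<^bsub>G\<^esub>"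
    proof -
      have "f \<one>\<^bsub>G\<^esub> \<oplus> f \<one>\<^bsub>G\<^esub> = f \<one>\<^bsub>G\<^esub>" using f_mult[of "\<one>\<^bsub>G\<^esub>" "\<one>\<^bsub>G\<^esub>"] one_aplus by simp
      then have "f \<one>\<^bsub>G\<^esub> = \<one>\<^bsub>G\<^esub>" using add.l_cancel_one[of "f \<one>\<^bsub>G\<^esub>" "f \<one>\<^bsub>G\<^esub>"] fG by simp
      then show ?thesis using add.r_inv[of "\<iota> x'"] x' by simp
    qed
    ultimately show ?thesis
      using f_mult[of "\<iota> x" "inv\<^bsub>A\<^esub> (\<iota> x')"] f_mult[of "\<iota> x'" "inv\<^bsub>A\<^esub> (\<iota> x')"] assms x' by simp
  qed
  then show ?thesis using assms x' by (simp add: D_def aplus_closed x'_def[symmetric])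
qed

lemma torsion_free_imp_injectivization_involutive:
  assumes tf: "torsion_free G" and xy: "x \<in> X" "y \<in> X"
  shows "\<iota> (\<sigma> y (\<psi> y x)) = \<iota> x"
proof -
  define x' where "x' = \<sigma> y (\<psi> y x)"
  have x': "x' \<in> X" using xy by (simp add: x'_def)
  define d where "d = \<iota> x \<oplus> inv\<^bsub>A\<^esub> (\<iota> x')"
  have "d \<in> D" using difference_in_D[OF xy] by (simp add: d_def x'_def)
  then have "d = \<one>\<^bsub>G\<^esub>" using D_torsion[of d] tf by (auto simp: torsion_free_def D_def)
  then have "\<iota> x = \<iota> x'"
    using add.inv_solve_right[of "\<one>\<^bsub>A\<^esub>" "\<iota> x" "\<iota> x'"] xy x' one_aplus by (simp add: d_def)
  then show ?thesis by (simp add: x'_def)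
qed

end

section \<open>Involutive injectivizations\<close>

lemma (in comm_group) hom_finprod:
  assumes h: "h \<in> hom G G" and "finite S" and f: "f \<in> S \<rightarrow> carrier G"
  shows "h (finprod G f S) = finprod G (\<lambda>x. h (f x)) S"
  using assms(2) f
proof (induction S rule: finite_induct)
  case empty
  then show ?case using hom_one[OF h is_group is_group] by simp
next
  case (insert x S)
  have hc: "h y \<in> carrier G" if "y \<in> carrier G" for y using h that by (auto simp: hom_def)
  have "f x \<in> carrier G" "f \<in> S \<rightarrow> carrier G" using insert.prems by auto
  then show ?case
    using insert hom_mult[OF h, of "f x" "finprod G f S"] hc
    by (subst (1 2) finprod_insert) (auto simp: Pi_iff)
qed

context finite_nondegenerate_solution
begin

section \<open>The lambda maps as additive automorphisms\<close>

lemma lambda_mult: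
  assumes "a \<in> carrier G" "b \<in> carrier G" "c \<in> carrier G"
  shows "lambda (a \<cdot> b) c = lambda a (lambda b c)"
proof -
  \<comment> \<open>The product of \<open>a\<close>, \<open>b\<close> and \<open>c\<close> is split
    in two ways, and the common summand \<open>a \<cdot> b\<close> is cancelled.\<close>
  have "a \<cdot> b \<oplus> lambda (a \<cdot> b) c = a \<cdot> (b \<cdot> c)"
    using mult_eq_aplus_lambda[of "a \<cdot> b" c] assms by (simp add: m_assoc)
  also have "\<dots> = a \<cdot> (b \<oplus> lambda b c)" using mult_eq_aplus_lambda[of b c] assms by simp
  also have "\<dots> = a \<cdot> b \<oplus> lambda a (lambda b c)"
    using assms by (simp add: brace_identity lambda_def aplus_assoc aplus_closed)
  finally show ?thesis
    using add.Units_l_cancel[of "a \<cdot> b"] assms by (simp add: add.Units_eq)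
qed

lemma lambda_one: "c \<in> carrier G \<Longrightarrow> lambda \<one>\<^bsub>G\<^esub> c = c"
  using mult_eq_aplus_lambda[of "\<one>\<^bsub>G\<^esub>" c] one_aplus[of "lambda \<one>\<^bsub>G\<^esub> c"] by simp

lemma lambda_lambda_inv:
  "a \<in> carrier G \<Longrightarrow> c \<in> carrier G \<Longrightarrow> lambda a (lambda (inv\<^bsub>G\<^esub> a) c) = c"
  using lambda_mult[of a "inv\<^bsub>G\<^esub> a" c] lambda_one by simp

lemma lambda_inv_lambda:
  "a \<in> carrier G \<Longrightarrow> c \<in> carrier G \<Longrightarrow> lambda (inv\<^bsub>G\<^esub> a) (lambda a c) = c"
  using lambda_mult[of "inv\<^bsub>G\<^esub> a" a c] lambda_one by simp

abbreviation I :: "'a gword set set" where "I \<equiv> \<iota> ` X"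

lemma I_closed: "q \<in> I \<Longrightarrow> q \<in> carrier G"
  by auto

lemma lambda_I: "a \<in> carrier G \<Longrightarrow> q \<in> I \<Longrightarrow> lambda a q \<in> I"
  by (auto simp: lambda_iota)

lemma lambda_bij_I: assumes a: "a \<in> carrier G" shows "bij_betw (lambda a) I I"
  by (rule bij_betw_byWitness[where f' = "lambda (inv\<^bsub>G\<^esub> a)"])
    (use a lambda_inv_lambda lambda_lambda_inv lambda_I I_closed in auto)

lemma lambda_in_hom: "a \<in> carrier G \<Longrightarrow> lambda a \<in> hom A A"
  by (auto simp: hom_def lambda_hom)

end

text \<open>By \<open>involutive_injectivization_iff\<close> the assumption expresses that the
  injectivization is involutive.\<close>

locale injectivization_involutive = finite_nondegenerate_solution +
  assumes iota_derived: "x \<in> X \<Longrightarrow> y \<in> X \<Longrightarrow> \<iota> (\<sigma> y (\<psi> y x)) = \<iota> x"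
begin

section \<open>Commutativity of the additive group\<close>

lemma aplus_commute_iota:
  assumes y: "y \<in> X" and g: "g \<in> carrier G"
  shows "g \<oplus> \<iota> y = \<iota> y \<oplus> g"
  using g
proof (induction g rule: T_induct)
  case one
  then show ?case using y by (simp add: aplus_one one_aplus)
next
  case (T g x)
  have "T x g \<oplus> \<iota> y = g \<oplus> (\<iota> x \<oplus> \<iota> y)"
    using T y by (simp add: aplus_iota[symmetric] aplus_assoc)
  also have "\<iota> x \<oplus> \<iota> y = \<iota> y \<oplus> \<iota> x"
    unfolding iota_aplus_iota[OF T(2) y] iota_derived[OF T(2) y] ..
  also have "g \<oplus> (\<iota> y \<oplus> \<iota> x) = T x (g \<oplus> \<iota> y)"
    using T y by (simp add: aplus_iota[of x] aplus_T)
  finally show ?case using T y by (simp add: aplus_T T_inject aplus_closed)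
qed

lemma aplus_commute:
  assumes g: "g \<in> carrier G" and h: "h \<in> carrier G"
  shows "g \<oplus> h = h \<oplus> g"
  using h
proof (induction h rule: T_induct)
  case one
  then show ?case using g by (simp add: aplus_one one_aplus)
next
  case (T h x)
  have "T x h \<oplus> g = h \<oplus> (\<iota> x \<oplus> g)"
    using T g by (simp add: aplus_iota[symmetric] aplus_assoc)
  also have "\<dots> = h \<oplus> (g \<oplus> \<iota> x)" using aplus_commute_iota[OF T(2) g] by simp
  also have "\<dots> = T x (h \<oplus> g)"
    using T g by (simp add: aplus_iota[of x] aplus_T)
  finally show ?case using T g by (simp add: aplus_T T_inject aplus_closed)
qed

sublocale add: comm_group A
  by (rule add.group_comm_groupI) (simp add: aplus_commute)

text \<open>The free abelian group on \<open>I\<close> is modelled by the integer functions on \<open>I\<close>; the multiplication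
  \<open>g \<mapsto> \<iota> x \<cdot> g = \<iota> x \<oplus> lambda (\<iota> x) g\<close> lifts to it as the affine map \<open>shift x\<close>.\<close>

definition shift :: "'a \<Rightarrow> ('a gword set \<Rightarrow> int) \<Rightarrow> 'a gword set \<Rightarrow> int" where
  "shift x f = (\<lambda>q\<in>I. of_bool (q = \<iota> x) + f (lambda (inv\<^bsub>G\<^esub> (\<iota> x)) q))"

definition affine_action ::
    "'a gword set \<Rightarrow> ('a gword set \<Rightarrow> int) \<Rightarrow> 'a gword set \<Rightarrow> int" where
  "affine_action = (SOME \<phi>. group_action G (extensional I) \<phi> \<and>
    (\<forall>x\<in>X. \<forall>f\<in>extensional I. \<phi> (\<iota> x) f = shift x f))"

lemma shift_apply: "q \<in> I \<Longrightarrow> shift x f q = of_bool (q = \<iota> x) + f (lambda (inv\<^bsub>G\<^esub> (\<iota> x)) q)"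
  by (simp add: shift_def)

lemma shift_bij: assumes x: "x \<in> X" shows "bij_betw (shift x) (extensional I) (extensional I)"
proof (rule bij_betw_byWitness)
  \<comment> \<open>The inverse map: change variables by \<open>lambda (\<iota> x)\<close> and
    subtract the indicator of \<open>\<iota> x\<close>.\<close>
  let ?g = "\<lambda>f. (\<lambda>q\<in>I. f (lambda (\<iota> x) q) - of_bool (lambda (\<iota> x) q = \<iota> x)) :: 'a gword set \<Rightarrow> int"
  have L: "lambda (\<iota> x) q \<in> I" "lambda (inv\<^bsub>G\<^esub> (\<iota> x)) q \<in> I"
    "lambda (inv\<^bsub>G\<^esub> (\<iota> x)) (lambda (\<iota> x) q) = q" "lambda (\<iota> x) (lambda (inv\<^bsub>G\<^esub> (\<iota> x)) q) = q"
    if "q \<in> I" for q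
    using x that I_closed[OF that] lambda_I[of _ q] by (simp_all add: lambda_inv_lambda lambda_lambda_inv)
  show "\<forall>f\<in>extensional I. ?g (shift x f) = f"
  proof (intro ballI extensionalityI[of _ I])
    fix f :: "'a gword set \<Rightarrow> int" and q assume "q \<in> I"
    then show "?g (shift x f) q = f q" using L[of q] by (simp add: shift_apply)
  qed auto
  show "\<forall>f\<in>extensional I. shift x (?g f) = f"
  proof (intro ballI extensionalityI[of _ I])
    fix f :: "'a gword set \<Rightarrow> int" and q assume "q \<in> I"
    then show "shift x (?g f) q = f q" using L[of q] by (simp add: shift_apply)
  qed (auto simp: shift_def)
qed (auto simp: shift_def extensional_def)

text \<open>The linear parts agree because \<open>\<iota> x \<cdot> \<iota> y\<close> determines
  them. The translation parts are the indicators of \<open>\<iota> x\<close> and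
  \<open>\<iota> (\<sigma> x y)\<close>, in one order and in the other; this is where
  \<open>iota_derived\<close> enters.\<close>

lemma shift_braid:
  assumes xy: "x \<in> X" "y \<in> X"
  shows "shift x (shift y f) = shift (\<sigma> x y) (shift (\<tau> y x) f)"
proof (rule extensionalityI[of _ I])
  have rel: "(lambda (inv\<^bsub>G\<^esub> (\<iota> a)) q = \<iota> b) = (q = \<iota> (\<sigma> a b))"
    if "a \<in> X" "b \<in> X" "q \<in> I" for a b q
  proof
    assume "lambda (inv\<^bsub>G\<^esub> (\<iota> a)) q = \<iota> b"
    then have "q = lambda (\<iota> a) (\<iota> b)"
      using lambda_lambda_inv[of "\<iota> a" q] that I_closed by auto
    then show "q = \<iota> (\<sigma> a b)" using lambda_iota[of "\<iota> a" b] lam_iota[of a b] that by simp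
  next
    assume "q = \<iota> (\<sigma> a b)"
    then have "q = lambda (\<iota> a) (\<iota> b)" using lambda_iota[of "\<iota> a" b] lam_iota[of a b] that by simp
    then show "lambda (inv\<^bsub>G\<^esub> (\<iota> a)) q = \<iota> b" using lambda_inv_lambda[of "\<iota> a" "\<iota> b"] that by simp
  qed
  have expand: "shift a (shift b f) q =
      of_bool (q = \<iota> a) + of_bool (q = \<iota> (\<sigma> a b)) + f (lambda (inv\<^bsub>G\<^esub> (\<iota> a \<cdot> \<iota> b)) q)"
    if ab: "a \<in> X" "b \<in> X" "q \<in> I" for a b q
    using lambda_I[of "inv\<^bsub>G\<^esub> (\<iota> a)" q] rel[OF ab] ab I_closed[OF ab(3)]
    by (simp add: shift_apply inv_mult_group lambda_mult)
  fix q assume q: "q \<in> I"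
  have "\<iota> (\<sigma> (\<sigma> x y) (\<tau> y x)) = \<iota> x"
    using iota_derived[of x "\<sigma> x y"] psi_sigma[of x y] xy by simp
  then show "shift x (shift y f) q = shift (\<sigma> x y) (shift (\<tau> y x) f) q"
    using expand[OF xy q] expand[of "\<sigma> x y" "\<tau> y x" q] iota_braid[OF xy] xy q by simp
qed (auto simp: shift_def)

lemma affine_action:
  "group_action G (extensional I) affine_action \<and>
    (\<forall>x\<in>X. \<forall>f\<in>extensional I. affine_action (\<iota> x) f = shift x f)"
  unfolding affine_action_def
  by (rule someI_ex[OF structure_group_action[OF shift_bij shift_braid]])

sublocale affine: group_action G "extensional I" affine_action
  using affine_action by simp

lemma affine_closed:
  "g \<in> carrier G \<Longrightarrow> f \<in> extensional I \<Longrightarrow> affine_action g f \<in> extensional I"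
  using affine.element_image by blast

lemma affine_mult_iota:
  assumes "h \<in> carrier G" "x \<in> X" "f \<in> extensional I"
  shows "affine_action (h \<cdot> \<iota> x) f = affine_action h (shift x f)"
  using affine.composition_rule[OF assms(3,1), of "\<iota> x"] affine_action assms by simp

lemma shift_surj:
  assumes "x \<in> X" "f \<in> extensional I" shows "\<exists>f'\<in>extensional I. shift x f' = f"
proof -
  have "f \<in> shift x ` extensional I"
    using bij_betw_imp_surj_on[OF shift_bij[OF assms(1)]] assms(2) by simp
  then show ?thesis by blast
qed

text \<open>Permuting coordinates and adding a fixed function \<open>c\<close> commutes with
  pointwise maxima, which is what the fixed point argument needs. To pass from
  \<open>h \<cdot> \<iota> x\<close> back to \<open>h\<close>, \<open>shift_surj\<close> writes an
  arbitrary function as a shifted one.\<close>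

lemma affine_action_apply:
  assumes "g \<in> carrier G"
  shows "\<exists>c. \<forall>f\<in>extensional I. \<forall>q\<in>I. affine_action g f q = c q + f (lambda (inv\<^bsub>G\<^esub> g) q)"
  using assms
proof (induction g rule: structure_group_induct)
  case one
  have "affine_action \<one>\<^bsub>G\<^esub> f = f" if "f \<in> extensional I" for f
    using affine.id_eq_one that by (metis restrict_apply')
  then have "\<forall>f\<in>extensional I. \<forall>q\<in>I. affine_action \<one>\<^bsub>G\<^esub> f q = 0 + f (lambda (inv\<^bsub>G\<^esub> \<one>\<^bsub>G\<^esub>) q)"
    by (auto simp: lambda_one)
  then show ?case by (rule exI[of _ "\<lambda>_. 0"])
next
  case (mult h x)
  have inv: "lambda (inv\<^bsub>G\<^esub> (h \<cdot> \<iota> x)) q = lambda (inv\<^bsub>G\<^esub> (\<iota> x)) (lambda (inv\<^bsub>G\<^esub> h) q)"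
    if "q \<in> I" for q
    using that mult I_closed[OF that] by (simp add: inv_mult_group lambda_mult)
  have sh: "shift x f (lambda (inv\<^bsub>G\<^esub> h) q)
      = of_bool (lambda (inv\<^bsub>G\<^esub> h) q = \<iota> x) + f (lambda (inv\<^bsub>G\<^esub> (h \<cdot> \<iota> x)) q)" if "q \<in> I" for f q
    using shift_apply[OF lambda_I[OF inv_closed[OF mult(1)] that]] inv[OF that] by simp
  show ?case
  proof
    assume "\<exists>c. \<forall>f\<in>extensional I. \<forall>q\<in>I.
      affine_action (h \<cdot> \<iota> x) f q = c q + f (lambda (inv\<^bsub>G\<^esub> (h \<cdot> \<iota> x)) q)"
    then obtain c where c: "\<And>f q. f \<in> extensional I \<Longrightarrow> q \<in> I \<Longrightarrow>
      affine_action (h \<cdot> \<iota> x) f q = c q + f (lambda (inv\<^bsub>G\<^esub> (h \<cdot> \<iota> x)) q)" by blast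
    have "affine_action h f q
        = (c q - of_bool (lambda (inv\<^bsub>G\<^esub> h) q = \<iota> x)) + f (lambda (inv\<^bsub>G\<^esub> h) q)"
      if f: "f \<in> extensional I" and q: "q \<in> I" for f q
    proof -
      obtain f' where f': "f' \<in> extensional I" "shift x f' = f"
        using shift_surj[OF mult(2) f] by blast
      show ?thesis
        using c[OF f'(1) q] affine_mult_iota[OF mult f'(1)] sh[OF q, of f'] f'(2) by simp
    qed
    then show "\<exists>c. \<forall>f\<in>extensional I. \<forall>q\<in>I. affine_action h f q = c q + f (lambda (inv\<^bsub>G\<^esub> h) q)"
      by (intro exI[of _ "\<lambda>q. c q - of_bool (lambda (inv\<^bsub>G\<^esub> h) q = \<iota> x)"]) blast
  next
    assume "\<exists>c. \<forall>f\<in>extensional I. \<forall>q\<in>I. affine_action h f q = c q + f (lambda (inv\<^bsub>G\<^esub> h) q)"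
    then obtain c where c: "\<And>f q. f \<in> extensional I \<Longrightarrow> q \<in> I \<Longrightarrow>
      affine_action h f q = c q + f (lambda (inv\<^bsub>G\<^esub> h) q)" by blast
    have "affine_action (h \<cdot> \<iota> x) f q
        = (c q + of_bool (lambda (inv\<^bsub>G\<^esub> h) q = \<iota> x)) + f (lambda (inv\<^bsub>G\<^esub> (h \<cdot> \<iota> x)) q)"
      if f: "f \<in> extensional I" and q: "q \<in> I" for f q
    proof -
      have "shift x f \<in> extensional I" by (simp add: shift_def)
      then show ?thesis
        using c[OF _ q, of "shift x f"] affine_mult_iota[OF mult f] sh[OF q, of f] by simp
    qed
    then show "\<exists>c. \<forall>f\<in>extensional I. \<forall>q\<in>I.
        affine_action (h \<cdot> \<iota> x) f q = c q + f (lambda (inv\<^bsub>G\<^esub> (h \<cdot> \<iota> x)) q)"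
      by (intro exI[of _ "\<lambda>q. c q + of_bool (lambda (inv\<^bsub>G\<^esub> h) q = \<iota> x)"]) blast
  qed
qed

text \<open>The pointwise maximum of a finite orbit is a fixed point.\<close>

lemma torsion_fixed_point:
  assumes g: "g \<in> carrier G" and n: "n > 0" "g [^]\<^bsub>G\<^esub> (n::nat) = \<one>\<^bsub>G\<^esub>"
  shows "\<exists>s\<in>extensional I. affine_action g s = s"
proof -
  define z :: "'a gword set \<Rightarrow> int" where "z = (\<lambda>q\<in>I. 0)"
  have z: "z \<in> extensional I" by (simp add: z_def)
  define u where "u i = affine_action (g [^]\<^bsub>G\<^esub> i) z" for i :: nat
  have u: "u i \<in> extensional I" for i using affine_closed z g by (simp add: u_def)
  have u_Suc: "u (Suc i) = affine_action g (u i)" for i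
    using affine.composition_rule[OF z g, of "g [^]\<^bsub>G\<^esub> i"] nat_pow_Suc2[OF g, of i] g
    by (simp add: u_def del: nat_pow_Suc)
  have u_n: "u n = u 0" by (simp add: u_def n(2))
  define s where "s = (\<lambda>q\<in>I. Max ((\<lambda>i. u i q) ` {..<n}))"
  have s: "s \<in> extensional I" by (simp add: s_def)
  obtain c where c: "\<And>f q. f \<in> extensional I \<Longrightarrow> q \<in> I \<Longrightarrow>
      affine_action g f q = c q + f (lambda (inv\<^bsub>G\<^esub> g) q)"
    using affine_action_apply[OF g] by blast
  have "affine_action g s = s"
  proof (rule extensionalityI[of _ I])
    show "affine_action g s \<in> extensional I" by (rule affine_closed[OF g s])
    show "s \<in> extensional I" by (rule s)
    fix q assume q: "q \<in> I"
    have q': "lambda (inv\<^bsub>G\<^esub> g) q \<in> I" using lambda_I g q by simp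
    have "affine_action g s q = Max ((\<lambda>i. u i (lambda (inv\<^bsub>G\<^esub> g) q)) ` {..<n}) + c q"
      using c[OF s q] q' by (simp add: s_def)
    also have "\<dots> = Max ((\<lambda>i. u i (lambda (inv\<^bsub>G\<^esub> g) q) + c q) ` {..<n})"
      by (rule Max_add_commute[symmetric]) (use n in auto)
    also have "(\<lambda>i. u i (lambda (inv\<^bsub>G\<^esub> g) q) + c q) ` {..<n} = (\<lambda>i. u (Suc i) q) ` {..<n}"
      using c[OF u q] by (intro image_cong) (simp_all add: u_Suc)
    also have "\<dots> = (\<lambda>i. u i q) ` {..<n}"
    proof -
      have "(\<lambda>i. u (Suc i) q) ` {..<n} = (\<lambda>i. u i q) ` (Suc ` {..<n})" by (simp add: image_image)
      \<comment> \<open>Cyclic shift of one period: index \<open>n\<close> replaces index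
        \<open>0\<close>, and \<open>u n = u 0\<close>.\<close>
      also have "Suc ` {..<n} = insert n ({..<n} - {0})"
      proof
        show "insert n ({..<n} - {0}) \<subseteq> Suc ` {..<n}"
        proof
          fix i assume "i \<in> insert n ({..<n} - {0})"
          then have "i = Suc (i - 1)" "i - 1 < n" using n(1) by auto
          then show "i \<in> Suc ` {..<n}" by blast
        qed
      qed auto
      also have "(\<lambda>i. u i q) ` insert n ({..<n} - {0}) = (\<lambda>i. u i q) ` insert 0 ({..<n} - {0})"
        by (simp only: image_insert u_n)
      also have "insert 0 ({..<n} - {0}) = {..<n}" using n(1) by auto
      finally show ?thesis .
    qed
    also have "Max ((\<lambda>i. u i q) ` {..<n}) = s q" using q by (simp add: s_def)
    finally show "affine_action g s q = s q" .
  qed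
  then show ?thesis using s by blast
qed

section \<open>Evaluation of formal sums in the additive group\<close>

definition evaluation :: "('a gword set \<Rightarrow> int) \<Rightarrow> 'a gword set" where
  "evaluation f = finprod A (\<lambda>q. q [^]\<^bsub>A\<^esub> f q) I"

lemma int_pow_A_closed: "q \<in> carrier G \<Longrightarrow> q [^]\<^bsub>A\<^esub> (n::int) \<in> carrier G"
  using add.int_pow_closed[of q n] by simp

lemma evaluation_closed: "evaluation f \<in> carrier G"
proof -
  have "(\<lambda>q. q [^]\<^bsub>A\<^esub> f q) \<in> I \<rightarrow> carrier A" using int_pow_A_closed by auto
  from add.finprod_closed[OF this] show ?thesis by (simp add: evaluation_def)
qed

text \<open>The indicator contributes the summand \<open>\<iota> x\<close>. The linear part,
  reindexed along the permutation \<open>lambda (\<iota> x)\<close> of \<open>I\<close>, contributes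
  \<open>lambda (\<iota> x) (evaluation f)\<close>, and the two add up to the product.\<close>

lemma evaluation_shift:
  assumes x: "x \<in> X"
  shows "evaluation (shift x f) = \<iota> x \<cdot> evaluation f"
proof -
  let ?l = "lambda (\<iota> x)" and ?l' = "lambda (inv\<^bsub>G\<^esub> (\<iota> x))"
  have pow: "q [^]\<^bsub>A\<^esub> (k::int) \<in> carrier A" if "q \<in> I" for q k
    using int_pow_A_closed that by auto
  have "evaluation (shift x f)
      = finprod A (\<lambda>q. (if q = \<iota> x then q else \<one>\<^bsub>A\<^esub>) \<oplus> q [^]\<^bsub>A\<^esub> f (?l' q)) I"
    unfolding evaluation_def
  proof (rule add.finprod_cong')
    show "(\<lambda>q. (if q = \<iota> x then q else \<one>\<^bsub>A\<^esub>) \<oplus> q [^]\<^bsub>A\<^esub> f (?l' q)) \<in> I \<rightarrow> carrier A"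
      using int_pow_A_closed x by (auto simp: aplus_closed)
    fix q assume "q \<in> I"
    then show "q [^]\<^bsub>A\<^esub> shift x f q = (if q = \<iota> x then q else \<one>\<^bsub>A\<^esub>) \<oplus> q [^]\<^bsub>A\<^esub> f (?l' q)"
      using I_closed[of q] add.int_pow_mult[of q 1 "f (?l' q)"] int_pow_A_closed[of q] one_aplus
      by (cases "q = \<iota> x") (simp_all add: shift_apply)
  qed simp
  also have "\<dots> = finprod A (\<lambda>q. if q = \<iota> x then q else \<one>\<^bsub>A\<^esub>) I
      \<oplus> finprod A (\<lambda>q. q [^]\<^bsub>A\<^esub> f (?l' q)) I"
    by (rule add.finprod_multf) (use pow x in auto)
  also have "finprod A (\<lambda>q. if q = \<iota> x then q else \<one>\<^bsub>A\<^esub>) I = \<iota> x"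
    by (rule add.finprod_singleton_swap) (use x finite_X in auto)
  also have "finprod A (\<lambda>q. q [^]\<^bsub>A\<^esub> f (?l' q)) I = finprod A (\<lambda>q. q [^]\<^bsub>A\<^esub> f (?l' q)) (?l ` I)"
    using bij_betw_imp_surj_on[OF lambda_bij_I[of "\<iota> x"]] x by simp
  also have "\<dots> = finprod A (\<lambda>p. ?l p [^]\<^bsub>A\<^esub> f (?l' (?l p))) I"
  proof (rule add.finprod_reindex)
    show "inj_on ?l I" using bij_betw_imp_inj_on[OF lambda_bij_I[of "\<iota> x"]] x by simp
    show "(\<lambda>q. q [^]\<^bsub>A\<^esub> f (?l' q)) \<in> ?l ` I \<rightarrow> carrier A"
      using pow lambda_I[OF iota_closed[OF x]] by blast
  qed
  also have "\<dots> = finprod A (\<lambda>p. ?l (p [^]\<^bsub>A\<^esub> f p)) I"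
  proof (rule add.finprod_cong')
    show "(\<lambda>p. ?l (p [^]\<^bsub>A\<^esub> f p)) \<in> I \<rightarrow> carrier A" using pow x by simp
    fix p assume "p \<in> I"
    then show "?l p [^]\<^bsub>A\<^esub> f (?l' (?l p)) = ?l (p [^]\<^bsub>A\<^esub> f p)"
      using hom_int_pow[OF lambda_in_hom[of "\<iota> x"], of p "f p"] I_closed[of p]
        lambda_inv_lambda[of "\<iota> x" p] x add.is_group by simp
  qed simp
  also have "\<dots> = ?l (evaluation f)"
    unfolding evaluation_def
    by (rule add.hom_finprod[symmetric]) (use x finite_X lambda_in_hom pow in auto)
  finally show ?thesis using mult_eq_aplus_lambda[of "\<iota> x" "evaluation f"] x evaluation_closed by simp
qed

text \<open>All \<open>f\<close> are treated at once so that the induction step can move from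
  \<open>f\<close> to \<open>shift x f\<close> and, by \<open>shift_surj\<close>, back.\<close>

lemma evaluation_equivariant:
  assumes "g \<in> carrier G"
  shows "\<forall>f\<in>extensional I. evaluation (affine_action g f) = g \<cdot> evaluation f"
  using assms
proof (induction g rule: structure_group_induct)
  case one
  have "affine_action \<one>\<^bsub>G\<^esub> f = f" if "f \<in> extensional I" for f
    using affine.id_eq_one that by (metis restrict_apply')
  then show ?case using evaluation_closed by simp
next
  case (mult h x)
  have step: "evaluation (affine_action (h \<cdot> \<iota> x) f) = h \<cdot> \<iota> x \<cdot> evaluation f \<longleftrightarrow>
      evaluation (affine_action h (shift x f)) = h \<cdot> evaluation (shift x f)"
    if "f \<in> extensional I" for f
    using that mult affine_mult_iota evaluation_shift evaluation_closed by (simp add: m_assoc)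
  show ?case
  proof
    assume 1: "\<forall>f\<in>extensional I. evaluation (affine_action (h \<cdot> \<iota> x) f) = h \<cdot> \<iota> x \<cdot> evaluation f"
    show "\<forall>f\<in>extensional I. evaluation (affine_action h f) = h \<cdot> evaluation f"
    proof
      fix f :: "'a gword set \<Rightarrow> int" assume "f \<in> extensional I"
      then obtain f' where f': "f' \<in> extensional I" "shift x f' = f"
        using shift_surj[OF mult(2)] by blast
      show "evaluation (affine_action h f) = h \<cdot> evaluation f"
        using step[OF f'(1)] 1[rule_format, OF f'(1)] f'(2) by simp
    qed
  next
    assume 1: "\<forall>f\<in>extensional I. evaluation (affine_action h f) = h \<cdot> evaluation f"
    show "\<forall>f\<in>extensional I. evaluation (affine_action (h \<cdot> \<iota> x) f) = h \<cdot> \<iota> x \<cdot> evaluation f"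
    proof
      fix f :: "'a gword set \<Rightarrow> int" assume f: "f \<in> extensional I"
      have "shift x f \<in> extensional I" by (simp add: shift_def)
      then show "evaluation (affine_action (h \<cdot> \<iota> x) f) = h \<cdot> \<iota> x \<cdot> evaluation f"
        using step[OF f] 1 by blast
    qed
  qed
qed

lemma structure_group_torsion_free: "torsion_free G"
  unfolding torsion_free_def
proof (intro ballI allI impI)
  fix g and n :: nat
  assume g: "g \<in> carrier G" and n: "n > 0" "g [^]\<^bsub>G\<^esub> n = \<one>\<^bsub>G\<^esub>"
  obtain s where s: "s \<in> extensional I" "affine_action g s = s"
    using torsion_fixed_point[OF g n] by blast
  \<comment> \<open>Equivariance turns the fixed function into an element of \<open>G\<close> fixed
    by left multiplication, which is then cancelled.\<close>
  then have "g \<cdot> evaluation s = evaluation s"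
    using evaluation_equivariant[OF g] by metis
  then show "g = \<one>\<^bsub>G\<^esub>" using g evaluation_closed[of s] by simp
qed

end

theorem theorem6p5:
  fixes X :: "'a set" and r :: "'a \<times> 'a \<Rightarrow> 'a \<times> 'a"
  assumes "nondegenerate_solution X r"
    and "finite X"
  shows "torsion_free (structure_group X r) \<longleftrightarrow>
    involutive_solution (inj_carrier X r) (inj_map X r)"
proof -
  interpret finite_nondegenerate_solution X r
    using assms by (simp add: finite_nondegenerate_solution_def finite_nondegenerate_solution_axioms_def)
  have "torsion_free G" if "\<forall>x\<in>X. \<forall>y\<in>X. \<iota> (\<sigma> y (\<psi> y x)) = \<iota> x"
  proof -
    interpret injectivization_involutive X r
      by unfold_locales (use that in blast)
    show ?thesis by (rule structure_group_torsion_free)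
  qed
  then show ?thesis
    using torsion_free_imp_injectivization_involutive
    unfolding involutive_injectivization_iff G_def[symmetric] by blast
qed

end
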